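(* The affine coordinate ring $R_\Upsilon$ of $\Upsilon_{\mathbb A}^{14}$ is a unique factorization domain.
   Context: Over $\mathbb C$. **Definition of $\Upsilon_{\mathbb A}^{14}$.** $\mathbb A_\Upsilon$ is the affine $18$-space with coordinates $u,x_1,x_2,y_1,y_2,p_1,p_2,p_3,p_4$ and $z,s_1,\dots,s_4,t_1,\dots,t_4$. Put $\mathsf{ST}_{ij}=s_it_j-s_jt_i$. $\Upsilon_{\mathbb A}^{14}$ is the closed subscheme defined by the vanishing of the nine polynomials $p_1^\sharp=-up_1-\big(x_1^2\mathsf{ST}_{12}+2x_1x_2\mathsf{ST}_{13}+x_2^2\mathsf{ST}_{14}+2x_1y_1\mathsf{ST}_{23}+(x_1y_2+x_2y_1)\mathsf{ST}_{24}+2x_2y_2\mathsf{ST}_{34}\big)$, $p_2^\sharp=-up_2+t_1(x_2y_1-x_1y_2)+t_2(y_1^2-zx_1^2)+2t_3(y_1y_2-zx_1x_2)+t_4(y_2^2-zx_2^2)$, $p_3^\sharp=up_3-\big(x_1y_1\mathsf{ST}_{12}+(x_1y_2+x_2y_1)\mathsf{ST}_{13}+x_2y_2\mathsf{ST}_{14}+(y_1^2+zx_1^2)\mathsf{ST}_{23}+(y_1y_2+zx_1x_2)\mathsf{ST}_{24}+(y_2^2+zx_2^2)\mathsf{ST}_{34}\big)$, $p_4^\sharp=-up_4+s_1(x_2y_1-x_1y_2)+s_2(y_1^2-zx_1^2)+2s_3(y_1y_2-zx_1x_2)+s_4(y_2^2-zx_2^2)$, $x_1^\sharp=-p_1y_1-p_3x_1+(p_2s_3-p_4t_3)x_1+(p_2s_4-p_4t_4)x_2$,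 $x_2^\sharp=-p_1y_2-p_3x_2-(p_2s_2-p_4t_2)x_1-(p_2s_3-p_4t_3)x_2$, $y_1^\sharp=(-zp_1+p_2s_1-p_4t_1)x_1-p_3y_1-(p_2s_3-p_4t_3)y_1-(p_2s_4-p_4t_4)y_2$, $y_2^\sharp=(-zp_1+p_2s_1-p_4t_1)x_2-p_3y_2+(p_2s_2-p_4t_2)y_1+(p_2s_3-p_4t_3)y_2$, $u^\sharp=-zp_1^2+p_1(p_2s_1-p_4t_1)+p_3^2-(p_2s_3-p_4t_3)^2+(p_2s_2-p_4t_2)(p_2s_4-p_4t_4)$. $R_\Upsilon$ is the quotient of the polynomial ring in the $18$ coordinates by the ideal generated by these nine polynomials. *)

theory Defs
  imports
    "HOL-Algebra.QuotRing"
    "HOL-Algebra.Ring_Divisibility"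
    "HOL-Algebra.Algebraic_Closure_Type"
    "HOL-Library.Poly_Mapping"
    Complex_Main
begin

datatype coord =
    U | X1 | X2 | Y1 | Y2 | P1 | P2 | P3 | P4
  | Z | S1 | S2 | S3 | S4 | T1 | T2 | T3 | T4

text \<open>
  The polynomial ring over the complex numbers in the 18 coordinates is the monoid algebra of
  the free commutative monoid \<open>coord \<Rightarrow>\<^sub>0 nat\<close> of monomials; the product of
  \<open>Poly_Mapping\<close> is the convolution product.
\<close>

type_synonym upsilon_poly = "(coord \<Rightarrow>\<^sub>0 nat) \<Rightarrow>\<^sub>0 complex"

definition var :: "coord \<Rightarrow> upsilon_poly" where
  "var c = Poly_Mapping.single (Poly_Mapping.single c 1) 1"

context
begin

private abbreviation (input) "u \<equiv> var U"
private abbreviation (input) "x1 \<equiv> var X1"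
private abbreviation (input) "x2 \<equiv> var X2"
private abbreviation (input) "y1 \<equiv> var Y1"
private abbreviation (input) "y2 \<equiv> var Y2"
private abbreviation (input) "p1 \<equiv> var P1"
private abbreviation (input) "p2 \<equiv> var P2"
private abbreviation (input) "p3 \<equiv> var P3"
private abbreviation (input) "p4 \<equiv> var P4"
private abbreviation (input) "z \<equiv> var Z"
private abbreviation (input) "s1 \<equiv> var S1"
private abbreviation (input) "s2 \<equiv> var S2"
private abbreviation (input) "s3 \<equiv> var S3"
private abbreviation (input) "s4 \<equiv> var S4"
private abbreviation (input) "t1 \<equiv> var T1"
private abbreviation (input) "t2 \<equiv> var T2"
private abbreviation (input) "t3 \<equiv> var T3"
private abbreviation (input) "t4 \<equiv> var T4"

private abbreviation (input) "ST12 \<equiv> s1 * t2 - s2 * t1"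
private abbreviation (input) "ST13 \<equiv> s1 * t3 - s3 * t1"
private abbreviation (input) "ST14 \<equiv> s1 * t4 - s4 * t1"
private abbreviation (input) "ST23 \<equiv> s2 * t3 - s3 * t2"
private abbreviation (input) "ST24 \<equiv> s2 * t4 - s4 * t2"
private abbreviation (input) "ST34 \<equiv> s3 * t4 - s4 * t3"

definition p1_sharp :: upsilon_poly where
  "p1_sharp = - u * p1
    - (x1^2 * ST12 + 2 * x1 * x2 * ST13 + x2^2 * ST14 + 2 * x1 * y1 * ST23
       + (x1 * y2 + x2 * y1) * ST24 + 2 * x2 * y2 * ST34)"

definition p2_sharp :: upsilon_poly where
  "p2_sharp = - u * p2 + t1 * (x2 * y1 - x1 * y2) + t2 * (y1^2 - z * x1^2)
    + 2 * t3 * (y1 * y2 - z * x1 * x2) + t4 * (y2^2 - z * x2^2)"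

definition p3_sharp :: upsilon_poly where
  "p3_sharp = u * p3
    - (x1 * y1 * ST12 + (x1 * y2 + x2 * y1) * ST13 + x2 * y2 * ST14
       + (y1^2 + z * x1^2) * ST23 + (y1 * y2 + z * x1 * x2) * ST24
       + (y2^2 + z * x2^2) * ST34)"

definition p4_sharp :: upsilon_poly where
  "p4_sharp = - u * p4 + s1 * (x2 * y1 - x1 * y2) + s2 * (y1^2 - z * x1^2)
    + 2 * s3 * (y1 * y2 - z * x1 * x2) + s4 * (y2^2 - z * x2^2)"

definition x1_sharp :: upsilon_poly where
  "x1_sharp = - p1 * y1 - p3 * x1 + (p2 * s3 - p4 * t3) * x1 + (p2 * s4 - p4 * t4) * x2"

definition x2_sharp :: upsilon_poly where
  "x2_sharp = - p1 * y2 - p3 * x2 - (p2 * s2 - p4 * t2) * x1 - (p2 * s3 - p4 * t3) * x2"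

definition y1_sharp :: upsilon_poly where
  "y1_sharp = (- z * p1 + p2 * s1 - p4 * t1) * x1 - p3 * y1
    - (p2 * s3 - p4 * t3) * y1 - (p2 * s4 - p4 * t4) * y2"

definition y2_sharp :: upsilon_poly where
  "y2_sharp = (- z * p1 + p2 * s1 - p4 * t1) * x2 - p3 * y2
    + (p2 * s2 - p4 * t2) * y1 + (p2 * s3 - p4 * t3) * y2"

definition u_sharp :: upsilon_poly where
  "u_sharp = - z * p1^2 + p1 * (p2 * s1 - p4 * t1) + p3^2 - (p2 * s3 - p4 * t3)^2
    + (p2 * s2 - p4 * t2) * (p2 * s4 - p4 * t4)"

end

definition upsilon_poly_ring :: "upsilon_poly ring" where
  "upsilon_poly_ring = ring_of_type_algebra"

definition upsilon_ideal :: "upsilon_poly set" where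
  "upsilon_ideal = Idl\<^bsub>upsilon_poly_ring\<^esub>
     {p1_sharp, p2_sharp, p3_sharp, p4_sharp, x1_sharp, x2_sharp, y1_sharp, y2_sharp, u_sharp}"

definition R_Upsilon :: "upsilon_poly set ring" where
  "R_Upsilon = upsilon_poly_ring Quot upsilon_ideal"

end

theory Submission
  imports Defs
    "HOL-Computational_Algebra.Polynomial_Factorial"
    "HOL-Computational_Algebra.Field_as_Ring"
    "HOL-Computational_Algebra.Fraction_Field"
    "HOL-Library.Countable"
begin
text \<open>
  Write \<open>E\<close> for the polynomial ring in the thirteen coordinates other than \<open>u, p1, p2, p3, p4\<close>. The
  equations \<open>p1_sharp\<close>, ..., \<open>p4_sharp\<close> say that \<open>u * p\<^sub>i\<close> is a certain element of \<open>E\<close>, so inverting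
  \<open>u\<close> turns \<open>R_Upsilon\<close> into \<open>E[u, 1/u]\<close>, which is factorial. Nagata's criterion descends
  factoriality to \<open>R_Upsilon\<close> once it is known that \<open>R_Upsilon\<close> is a domain in which \<open>u\<close> is prime.

  The domain property comes from the morphism \<open>Phi\<close> into Laurent polynomials that sends \<open>p\<^sub>i\<close> to its
  value after inverting \<open>u\<close>. It kills the ideal; for the last generator this follows from the middle
  ones, because a combination of them is a multiple of it (\<open>x1_times_u_sharp\<close>). Conversely the nine generators straighten every polynomial to
  a combination of standard monomials, those divisible by none of nine leading monomials
  (\<open>straightens_all\<close>), and for a suitable second weight the images of the standard monomials have
  pairwise different leading exponents (\<open>lead_exponent_inj\<close>). Hence \<open>Phi\<close> is injective on standard
  combinations and its kernel is exactly the ideal (\<open>kernel_Phi\<close>): \<open>R_Upsilon\<close> is the image of \<open>Phi\<close>.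

  For the primality of \<open>u\<close> put \<open>q\<^sub>t = x1\<^sup>2 t2 + 2 x1 x2 t3 + x2\<^sup>2 t4\<close>. Where \<open>q\<^sub>t\<close> is invertible, the
  hypersurface \<open>u = 0\<close> is an open part of an affine space, since the equations can be solved for
  \<open>z, s1, p3, p4\<close>; this gives a morphism \<open>Chi\<close> into a field that kills the ideal and \<open>u\<close>. The leading
  monomial of \<open>q\<^sub>t\<close> involves only \<open>x2\<close> and \<open>t4\<close>, which occur in no leading monomial of a generator,
  and so the same comparison of leading exponents shows that \<open>q\<^sub>t\<close> is not a zero divisor modulo \<open>u\<close>
  (\<open>u_multiple_cancel_q_t\<close>). Therefore the multiples of \<open>u\<close> are the kernel of \<open>Chi\<close>
  (\<open>u_multiple_iff_Chi\<close>), a prime ideal.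

  Nagata's criterion also asks that a nonzero element be divisible by only finitely many powers of
  \<open>u\<close>. This follows from a grading of the image of \<open>Phi\<close> in nonnegative degrees in which \<open>u\<close> has
  degree \<open>1\<close> (\<open>finitely_many_u_powers\<close>).
\<close>

section \<open>A criterion of Nagata for factoriality\<close>

definition divides_in :: "'a::comm_ring_1 set \<Rightarrow> 'a \<Rightarrow> 'a \<Rightarrow> bool" where
  "divides_in A a b \<longleftrightarrow> (\<exists>c\<in>A. b = a * c)"

text \<open>Units count as primes here. This makes products of primes closed under associates, so
  that no unit factor has to be carried along.\<close>

definition prime_in :: "'a::comm_ring_1 set \<Rightarrow> 'a \<Rightarrow> bool" where
  "prime_in A p \<longleftrightarrow> p \<in> A \<and> p \<noteq> 0 \<and>
     (\<forall>a\<in>A. \<forall>b\<in>A. divides_in A p (a * b) \<longrightarrow> divides_in A p a \<or> divides_in A p b)"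

definition prime_product_in :: "'a::comm_ring_1 set \<Rightarrow> 'a \<Rightarrow> bool" where
  "prime_product_in A a \<longleftrightarrow> (\<exists>ps. (\<forall>p\<in>set ps. prime_in A p) \<and> a = prod_list ps)"

locale mult_subset =
  fixes A :: "'l::idom set"
  assumes one_in: "1 \<in> A"
    and mult_in: "a \<in> A \<Longrightarrow> b \<in> A \<Longrightarrow> a * b \<in> A"
begin

lemma power_in: "a \<in> A \<Longrightarrow> a ^ n \<in> A"
  by (induction n) (auto intro: one_in mult_in)

lemma prime_product_prime: "prime_in A p \<Longrightarrow> prime_product_in A p"
  unfolding prime_product_in_def by (intro exI[of _ "[p]"]) simp

lemma prime_product_mult:
  assumes "prime_product_in A a" "prime_product_in A b"
  shows "prime_product_in A (a * b)"
proof -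
  obtain ps qs where "\<forall>p\<in>set ps. prime_in A p" "a = prod_list ps"
    "\<forall>p\<in>set qs. prime_in A p" "b = prod_list qs"
    using assms unfolding prime_product_in_def by blast
  then show ?thesis
    unfolding prime_product_in_def by (intro exI[of _ "ps @ qs"]) auto
qed

lemma prime_in_unit:
  assumes "f \<in> A" "g \<in> A" "f * g = 1"
  shows "prime_in A f"
proof -
  have "divides_in A f b" if "b \<in> A" for b
  proof -
    have "b = f * (g * b)" using assms(3) by (simp add: mult.assoc[symmetric])
    then show ?thesis unfolding divides_in_def using mult_in[OF assms(2) that] by blast
  qed
  then show ?thesis unfolding prime_in_def using assms by auto
qed

text \<open>Each prime factor of a product divides one of the two factors; cancelling it there
  shortens the list.\<close>

lemma prime_product_divisor:
  assumes "prime_product_in A (f * g)" "f \<in> A" "g \<in> A"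
  shows "prime_product_in A f"
proof -
  obtain ps where "\<forall>p\<in>set ps. prime_in A p" "prod_list ps = f * g"
    using assms(1) unfolding prime_product_in_def by metis
  then show ?thesis using assms(2,3)
  proof (induction ps arbitrary: f g)
    case Nil
    then show ?case using prime_in_unit prime_product_prime by auto
  next
    case (Cons p ps)
    have p: "prime_in A p" "p \<in> A" "p \<noteq> 0" and IH: "\<forall>p\<in>set ps. prime_in A p"
      using Cons.prems by (auto simp: prime_in_def)
    have prod_in: "prod_list qs \<in> A" if "\<forall>p\<in>set qs. prime_in A p" for qs
      using that by (induction qs) (auto intro: one_in mult_in simp: prime_in_def)
    have "divides_in A p (f * g)"
      unfolding divides_in_def using Cons.prems(2) prod_in[OF IH]
      by (intro bexI[of _ "prod_list ps"]) auto
    then consider "divides_in A p f" | "divides_in A p g"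
      using p Cons.prems unfolding prime_in_def by blast
    then show ?case
    proof cases
      case 1
      then obtain c where c: "c \<in> A" "f = p * c" unfolding divides_in_def by blast
      with Cons.prems p have "prod_list ps = c * g" by (simp add: mult.assoc)
      with Cons.IH[OF IH this c(1)] Cons.prems have "prime_product_in A c" by blast
      then show ?thesis using c prime_product_mult prime_product_prime[OF p(1)] by auto
    next
      case 2
      then obtain c where c: "c \<in> A" "g = p * c" unfolding divides_in_def by blast
      with Cons.prems p have "prod_list ps = f * c"
        by (simp add: mult.left_commute)
      with Cons.IH[OF IH this _ c(1)] Cons.prems show ?thesis by blast
    qed
  qed
qed

end

text \<open>The locale says that \<open>A\<close> and its factorial subring \<open>j ` UNIV\<close> have the same localization
  at the powers of the prime \<open>u\<close>, and that nonzero elements of \<open>A\<close> are divisible by only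
  finitely many powers of \<open>u\<close>. Then \<open>A\<close> inherits factoriality, as
  \<open>prime_product_all\<close> shows.\<close>

locale nagata = mult_subset A
  for A :: "'l::idom set" +
  fixes j :: "'q::factorial_semiring \<Rightarrow> 'l" and v :: 'q and u :: 'l
  assumes j_mult: "j (p * q) = j p * j q"
    and j_one: "j 1 = 1"
    and j_zero: "j 0 = 0"
    and j_inj: "inj j"
    and j_in: "j p \<in> A"
    and j_v: "j v = u"
    and u_nonzero: "u \<noteq> 0"
    and u_prime: "a \<in> A \<Longrightarrow> b \<in> A \<Longrightarrow> divides_in A u (a * b) \<Longrightarrow> divides_in A u a \<or> divides_in A u b"
    and clear_u: "a \<in> A \<Longrightarrow> \<exists>n q. u ^ n * a = j q"
    and finite_u: "a \<in> A \<Longrightarrow> a \<noteq> 0 \<Longrightarrow> \<exists>N. \<forall>n. \<forall>b\<in>A. a = u ^ n * b \<longrightarrow> n \<le> N"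
begin

lemma u_in: "u \<in> A"
  using j_in[of v] j_v by simp

lemma prime_in_u: "prime_in A u"
  unfolding prime_in_def using u_in u_nonzero u_prime by blast

lemma j_power: "j (a ^ n) = j a ^ n"
  by (induction n) (auto simp: j_one j_mult)

lemma divides_cancel_u_power:
  assumes "\<not> divides_in A u r" "r \<in> A"
  shows "a \<in> A \<Longrightarrow> w \<in> A \<Longrightarrow> u ^ n * a = r * w \<Longrightarrow> divides_in A r a"
proof (induction n arbitrary: w)
  case 0
  then show ?case unfolding divides_in_def by auto
next
  case (Suc n)
  have "divides_in A u (r * w)"
    unfolding divides_in_def using Suc.prems mult_in[OF power_in[OF u_in] Suc.prems(1), of n]
    by (intro bexI[of _ "u ^ n * a"]) (auto simp: mult.assoc)
  then have "divides_in A u w" using u_prime assms Suc.prems by blast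
  then obtain d where d: "d \<in> A" "w = u * d" unfolding divides_in_def by blast
  then have "u * (u ^ n * a) = u * (r * d)" using Suc.prems by (simp add: ac_simps)
  then have "u ^ n * a = r * d" using u_nonzero by simp
  then show ?case using Suc d by blast
qed

text \<open>After all factors \<open>u\<close> have been split off, a prime of the factorial subring stays prime:
  products are compared after multiplication by a power of \<open>u\<close>, where they live in the
  subring.\<close>

lemma prime_product_j_prime:
  assumes "prime_elem p"
  shows "prime_product_in A (j p)"
proof (cases "p dvd v")
  case True
  then obtain e where "v = p * e" by blast
  then have "u = j p * j e" using j_v j_mult by auto
  then show ?thesis
    using prime_product_divisor[of "j p" "j e"] prime_product_prime[OF prime_in_u] j_in by auto
next
  case False
  have jp0: "j p \<noteq> 0"
    using j_inj j_zero prime_elem_not_zeroI[OF assms] by (metis assms injD prime_elem_def)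
  define P where "P n \<longleftrightarrow> (\<exists>b\<in>A. j p = u ^ n * b)" for n
  obtain N where N: "\<And>n. P n \<Longrightarrow> n \<le> N"
    using finite_u[OF j_in jp0] unfolding P_def by blast
  have "P 0" unfolding P_def using j_in by auto
  define n where "n = (GREATEST n. P n)"
  have "P n" unfolding n_def using \<open>P 0\<close> N by (rule GreatestI_nat)
  then obtain r where r: "r \<in> A" "j p = u ^ n * r" unfolding P_def by blast
  have "\<not> divides_in A u r"
  proof
    assume "divides_in A u r"
    then obtain d where "d \<in> A" "r = u * d" unfolding divides_in_def by blast
    then have "P (Suc n)" unfolding P_def using r by (intro bexI[of _ d]) auto
    then have "Suc n \<le> n" unfolding n_def using N by (rule Greatest_le_nat)
    then show False by simp
  qed
  note cancel = divides_cancel_u_power[OF this r(1)]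
  have "prime_in A r"
    unfolding prime_in_def
  proof (intro conjI ballI impI)
    show "r \<in> A" by (rule r(1))
    show "r \<noteq> 0" using jp0 r by auto
    fix g h assume gh: "g \<in> A" "h \<in> A" "divides_in A r (g * h)"
    obtain c where c: "c \<in> A" "g * h = r * c" using gh unfolding divides_in_def by blast
    obtain a g' where g': "u ^ a * g = j g'" using clear_u[OF gh(1)] by blast
    obtain b h' where h': "u ^ b * h = j h'" using clear_u[OF gh(2)] by blast
    obtain e c' where c': "u ^ e * c = j c'" using clear_u[OF c(1)] by blast
    have "j (g' * h' * v ^ (n + e)) = u ^ a * g * (u ^ b * h) * u ^ (n + e)"
      by (simp add: j_mult g' h' j_power j_v)
    also have "\<dots> = (g * h) * u ^ (a + b + n + e)" by (simp add: power_add ac_simps)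
    also have "\<dots> = (u ^ n * r) * (u ^ e * c) * u ^ (a + b)"
      by (simp add: c(2) power_add ac_simps)
    also have "\<dots> = j (p * (c' * v ^ (a + b)))"
      by (simp add: j_mult c'[symmetric] r(2) j_power j_v ac_simps)
    finally have "g' * h' * v ^ (n + e) = p * (c' * v ^ (a + b))"
      using j_inj by (simp add: inj_def)
    then have "p dvd g' * h' * v ^ (n + e)" by simp
    then have "p dvd g' \<or> p dvd h'"
      using assms False by (metis prime_elem_dvd_mult_iff prime_elem_dvd_power)
    moreover have "divides_in A r x" if "p dvd x'" "u ^ m * x = j x'" "x \<in> A" for x x' m
    proof -
      obtain k where "x' = p * k" using \<open>p dvd x'\<close> unfolding dvd_def by blast
      then have "u ^ m * x = j p * j k" using \<open>u ^ m * x = j x'\<close> j_mult by simp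
      also have "\<dots> = r * (u ^ n * j k)" using r(2) by (simp add: ac_simps)
      finally have "u ^ m * x = r * (u ^ n * j k)" .
      then show ?thesis
        using cancel[OF that(3)] mult_in[OF power_in[OF u_in, of n] j_in[of k]] by blast
    qed
    ultimately show "divides_in A r g \<or> divides_in A r h"
      using g' h' gh by blast
  qed
  moreover have "prime_product_in A (u ^ n)"
  proof (induction n)
    case 0
    show ?case using prime_product_prime[OF prime_in_unit[OF one_in one_in]] by simp
  next
    case (Suc n)
    then show ?case using prime_product_mult prime_product_prime[OF prime_in_u] by simp
  qed
  ultimately show ?thesis using r(2) prime_product_mult prime_product_prime by simp
qed

lemma prime_product_j:
  assumes "q \<noteq> 0"
  shows "prime_product_in A (j q)"
proof -
  obtain M where M: "\<And>x. x \<in># M \<Longrightarrow> prime_elem x" "normalize (prod_mset M) = normalize q"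
    using prime_factorization_exists[OF assms] by blast
  have M_prod: "prime_product_in A (j (prod_mset M))" using M(1)
  proof (induction M)
    case empty
    show ?case using prime_product_prime[OF prime_in_unit[OF one_in one_in]] by (simp add: j_one)
  next
    case (add x M)
    then show ?case by (auto simp: j_mult intro: prime_product_mult prime_product_j_prime)
  qed
  have "q dvd prod_mset M" using M(2) by (metis associated_iff_dvd)
  then obtain e where "prod_mset M = q * e" by blast
  then show ?thesis using M_prod prime_product_divisor[of "j q" "j e"] j_in j_mult by auto
qed

theorem prime_product_all:
  assumes "a \<in> A" "a \<noteq> 0"
  shows "prime_product_in A a"
proof -
  obtain n q where q: "u ^ n * a = j q" using clear_u[OF assms(1)] by blast
  have "q \<noteq> 0" using q j_zero assms u_nonzero by auto
  then have "prime_product_in A (a * u ^ n)" using prime_product_j q by (simp add: mult.commute)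
  then show ?thesis using prime_product_divisor assms power_in[OF u_in] by blast
qed

end

text \<open>An irreducible element has a prime factor to which it is associated, so it is prime; this
  yields uniqueness of factorizations.\<close>

lemma (in comm_monoid_cancel) factorial_monoidI_prime_products:
  assumes "\<And>a. a \<in> carrier G \<Longrightarrow>
    \<exists>ps. (\<forall>p\<in>set ps. p \<in> carrier G \<and> (p \<in> Units G \<or> Divisibility.prime G p)) \<and> a = foldr (\<otimes>) ps \<one>"
  shows "factorial_monoid G"
proof -
  have drop_units: "\<exists>qs. set qs \<subseteq> carrier G \<and> (\<forall>q\<in>set qs. Divisibility.prime G q) \<and> foldr (\<otimes>) qs \<one> \<sim> foldr (\<otimes>) ps \<one>"
    if "\<forall>p\<in>set ps. p \<in> carrier G \<and> (p \<in> Units G \<or> Divisibility.prime G p)" for ps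
    using that
  proof (induction ps)
    case Nil
    show ?case by (intro exI[of _ "[]"]) simp
  next
    case (Cons p ps)
    then obtain qs where qs: "set qs \<subseteq> carrier G" "\<forall>q\<in>set qs. Divisibility.prime G q"
      "foldr (\<otimes>) qs \<one> \<sim> foldr (\<otimes>) ps \<one>" by auto
    have carr: "p \<in> carrier G" "foldr (\<otimes>) ps \<one> \<in> carrier G" "foldr (\<otimes>) qs \<one> \<in> carrier G"
      using Cons.prems qs by (auto intro!: multlist_closed)
    show ?case
    proof (cases "p \<in> Units G")
      case True
      then have "foldr (\<otimes>) ps \<one> \<sim> p \<otimes> foldr (\<otimes>) ps \<one>"
        using carr by (metis Units_closed associatedI2 m_comm associated_sym)
      then show ?thesis using qs carr by (auto intro: associated_trans)
    next
      case False
      then show ?thesis using qs carr Cons.prems mult_cong_r[OF qs(3) carr(1,3,2)]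
        by (intro exI[of _ "p # qs"]) auto
    qed
  qed
  have prime_factors: "\<exists>qs. set qs \<subseteq> carrier G \<and> (\<forall>q\<in>set qs. Divisibility.prime G q) \<and> foldr (\<otimes>) qs \<one> \<sim> a"
    if "a \<in> carrier G" for a
    using assms[OF that] drop_units by metis
  interpret primeness_condition_monoid G
  proof
    fix a assume a: "a \<in> carrier G" "Divisibility.irreducible G a"
    then obtain qs where qs: "set qs \<subseteq> carrier G" "\<forall>q\<in>set qs. Divisibility.prime G q"
      "foldr (\<otimes>) qs \<one> \<sim> a" using prime_factors by blast
    show "Divisibility.prime G a"
    proof (cases qs)
      case Nil
      then have "a \<in> Units G" using qs a Units_cong Units_one_closed by auto
      then show ?thesis using a unfolding Divisibility.irreducible_def by blast
    next
      case (Cons q qs')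
      have carr: "q \<in> carrier G" "foldr (\<otimes>) qs' \<one> \<in> carrier G"
        using Cons qs by (auto intro!: multlist_closed)
      have "q divides (q \<otimes> foldr (\<otimes>) qs' \<one>)" using carr by (auto simp: factor_def)
      then have "q divides a" using qs Cons carr a by (auto dest: associatedD intro: divides_trans)
      moreover have "q \<notin> Units G" using qs Cons unfolding Divisibility.prime_def by auto
      ultimately have "q \<sim> a"
        using a carr unfolding Divisibility.irreducible_def properfactor_def associated_def by blast
      then show ?thesis using prime_cong qs Cons carr a by auto
    qed
  qed
  show ?thesis
  proof (rule factorial_monoidI)
    fix a assume a: "a \<in> carrier G"
    show "\<exists>fs. set fs \<subseteq> carrier G \<and> wfactors G fs a"
      using prime_factors[OF a] prime_irreducible unfolding wfactors_def by blast
  qed (rule wfactors_unique)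
qed

text \<open>Primes only have to be tested in an isomorphic copy of \<open>R\<close> inside an integral domain type.\<close>

lemma (in domain) factorial_domainI_prime_products:
  fixes h :: "'a \<Rightarrow> 'l::idom"
  assumes h_mult: "\<And>x y. x \<in> carrier R \<Longrightarrow> y \<in> carrier R \<Longrightarrow> h (x \<otimes> y) = h x * h y"
    and h_one: "h \<one> = 1" and h_zero: "h \<zero> = 0"
    and bij: "bij_betw h (carrier R) A"
    and prods: "\<And>a. a \<in> A \<Longrightarrow> a \<noteq> 0 \<Longrightarrow> prime_product_in A a"
  shows "factorial_domain R"
proof -
  have h_in: "h x \<in> A" if "x \<in> carrier R" for x
    using bij that unfolding bij_betw_def by blast
  have h_inj: "h x = h y \<longleftrightarrow> x = y" if "x \<in> carrier R" "y \<in> carrier R" for x y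
    using bij that unfolding bij_betw_def inj_on_def by blast
  have zero: "h x = 0 \<longleftrightarrow> x = \<zero>" if "x \<in> carrier R" for x
    using h_inj[OF that zero_closed] h_zero by simp
  let ?M = "mult_of R"
  have divides: "x divides\<^bsub>?M\<^esub> y \<longleftrightarrow> divides_in A (h x) (h y)"
    if x: "x \<in> carrier R" "x \<noteq> \<zero>" and y: "y \<in> carrier R" "y \<noteq> \<zero>" for x y
  proof
    assume "x divides\<^bsub>?M\<^esub> y"
    then obtain c where c: "c \<in> carrier R" "y = x \<otimes> c"
      unfolding factor_def mult_mult_of carrier_mult_of by blast
    then have "h y = h x * h c" using h_mult x by blast
    then show "divides_in A (h x) (h y)"
      unfolding divides_in_def using h_in[OF c(1)] by blast
  next
    assume "divides_in A (h x) (h y)"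
    then obtain c where "c \<in> A" "h y = h x * c" unfolding divides_in_def by blast
    then obtain d where d: "d \<in> carrier R" "c = h d" using bij unfolding bij_betw_def by blast
    then have "h y = h (x \<otimes> d)" using h_mult x \<open>h y = h x * c\<close> by simp
    then have "y = x \<otimes> d" using h_inj x y d by simp
    moreover from this have "d \<noteq> \<zero>" using x y by auto
    ultimately show "x divides\<^bsub>?M\<^esub> y" unfolding factor_def using d by auto
  qed
  have "factorial_monoid ?M"
  proof (rule mult_of.factorial_monoidI_prime_products)
    fix a assume a: "a \<in> carrier ?M"
    then have "prime_product_in A (h a)" using prods h_in zero by simp
    then obtain ps where ps: "\<forall>p\<in>set ps. prime_in A p" "h a = prod_list ps"
      unfolding prime_product_in_def by blast
    define g where "g = inv_into (carrier R) h"
    have inv: "g p \<in> carrier R" "h (g p) = p" if "p \<in> set ps" for p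
    proof -
      have "p \<in> h ` carrier R"
        using ps(1) that bij unfolding prime_in_def bij_betw_def by blast
      then show "g p \<in> carrier R" "h (g p) = p"
        unfolding g_def by (auto simp: inv_into_into f_inv_into_f)
    qed
    have "foldr (\<otimes>) (map g ps) \<one> \<in> carrier R \<and> h (foldr (\<otimes>) (map g ps) \<one>) = prod_list ps"
      using inv by (induction ps) (auto simp: h_one h_mult)
    then have "a = foldr (\<otimes>) (map g ps) \<one>" using ps(2) h_inj a by (metis DiffD1 carrier_mult_of)
    moreover have "q \<in> carrier ?M \<and> (q \<in> Units ?M \<or> Divisibility.prime ?M q)"
      if "q \<in> set (map g ps)" for q
    proof -
      have q: "q \<in> carrier R" "prime_in A (h q)" using that inv ps(1) by auto
      then have q0: "q \<noteq> \<zero>" using h_zero unfolding prime_in_def by auto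
      have "Divisibility.prime ?M q" if "q \<notin> Units ?M"
        unfolding Divisibility.prime_def
      proof (intro conjI ballI impI)
        fix x y assume xy: "x \<in> carrier ?M" "y \<in> carrier ?M" "q divides\<^bsub>?M\<^esub> x \<otimes>\<^bsub>?M\<^esub> y"
        then have "x \<in> carrier R" "x \<noteq> \<zero>" "y \<in> carrier R" "y \<noteq> \<zero>" by auto
        moreover from this have "x \<otimes> y \<in> carrier R" "x \<otimes> y \<noteq> \<zero>" using integral by auto
        moreover from this have "divides_in A (h q) (h x * h y)"
          using divides[OF q(1) q0] xy(3) h_mult[of x y] calculation by simp
        ultimately show "q divides\<^bsub>?M\<^esub> x \<or> q divides\<^bsub>?M\<^esub> y"
          using q q0 divides h_in unfolding prime_in_def by meson
      qed (rule that)
      then show ?thesis using q q0 by auto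
    qed
    ultimately show "\<exists>ps. (\<forall>p\<in>set ps. p \<in> carrier ?M \<and> (p \<in> Units ?M \<or> Divisibility.prime ?M p)) \<and>
      a = foldr (\<otimes>) ps \<one>" by blast
  qed
  then show ?thesis by (simp add: factorial_domain_def domain_axioms)
qed

lemma factorial_domain_quotient:
  fixes \<phi> :: "'p::comm_ring_1 \<Rightarrow> 'l::idom"
  assumes add: "\<And>a b. \<phi> (a + b) = \<phi> a + \<phi> b"
    and mult: "\<And>a b. \<phi> (a * b) = \<phi> a * \<phi> b"
    and one: "\<phi> 1 = 1"
    and prods: "\<And>a. a \<in> range \<phi> \<Longrightarrow> a \<noteq> 0 \<Longrightarrow> prime_product_in (range \<phi>) a"
  shows "factorial_domain (ring_of_type_algebra Quot {f. \<phi> f = 0})"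
proof -
  let ?P = "ring_of_type_algebra :: 'p ring" and ?L = "ring_of_type_algebra :: 'l ring"
  let ?A = "?L\<lparr>carrier := range \<phi>\<rparr>"
  have ops: "carrier ?P = UNIV" "monoid.mult ?P = (*)" "add ?P = (+)" "\<one>\<^bsub>?P\<^esub> = 1" "\<zero>\<^bsub>?P\<^esub> = 0"
    "carrier ?L = UNIV" "monoid.mult ?L = (*)" "add ?L = (+)" "\<one>\<^bsub>?L\<^esub> = 1" "\<zero>\<^bsub>?L\<^esub> = 0"
    by (simp_all add: ring_of_type_algebra_def)
  have "ring ?P" "ring ?L"
    using cring_from_type_algebra cring.axioms(1) by blast+
  then interpret hom: ring_hom_ring ?P ?L \<phi>
    by (intro ring_hom_ringI) (auto simp: ops add mult one)
  interpret P: cring ?P using cring_from_type_algebra .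
  have ker: "{f. \<phi> f = 0} = a_kernel ?P ?L \<phi>"
    unfolding a_kernel_def' by (auto simp: ops)
  define R where "R = ?P Quot {f. \<phi> f = 0}"
  interpret R: cring R
    unfolding R_def ker by (rule ideal.quotient_is_cring[OF hom.kernel_is_ideal P.cring_axioms])
  obtain h where h: "h \<in> ring_iso R ?A"
    using hom.FactRing_iso_set_aux unfolding R_def ker ops by blast
  have h_mult: "h (x \<otimes>\<^bsub>R\<^esub> y) = h x * h y" if "x \<in> carrier R" "y \<in> carrier R" for x y
    using that h unfolding ring_iso_def ring_hom_def by (simp add: ops)
  have h_add: "h (x \<oplus>\<^bsub>R\<^esub> y) = h x + h y" if "x \<in> carrier R" "y \<in> carrier R" for x y
    using that h unfolding ring_iso_def ring_hom_def by (simp add: ops)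
  have h_one: "h \<one>\<^bsub>R\<^esub> = 1" using h unfolding ring_iso_def ring_hom_def by (simp add: ops)
  have bij: "bij_betw h (carrier R) (range \<phi>)" using h unfolding ring_iso_def by simp
  have "h \<zero>\<^bsub>R\<^esub> + h \<zero>\<^bsub>R\<^esub> = h \<zero>\<^bsub>R\<^esub>" using h_add[OF R.zero_closed R.zero_closed] by simp
  then have h_zero: "h \<zero>\<^bsub>R\<^esub> = 0" by (rule iffD1[OF add_cancel_right_right, OF sym])
  have "domain R"
  proof (unfold_locales)
    show "\<one>\<^bsub>R\<^esub> \<noteq> \<zero>\<^bsub>R\<^esub>" using h_one h_zero by auto
    fix a b assume ab: "a \<otimes>\<^bsub>R\<^esub> b = \<zero>\<^bsub>R\<^esub>" "a \<in> carrier R" "b \<in> carrier R"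
    then have "h a * h b = 0" using h_mult[OF ab(2,3)] h_zero by metis
    then have "h a = h \<zero>\<^bsub>R\<^esub> \<or> h b = h \<zero>\<^bsub>R\<^esub>" using h_zero mult_eq_0_iff by metis
    then show "a = \<zero>\<^bsub>R\<^esub> \<or> b = \<zero>\<^bsub>R\<^esub>"
      using bij_betw_imp_inj_on[OF bij] ab(2,3) R.zero_closed unfolding inj_on_def by blast
  qed
  then have "factorial_domain R"
    using h_mult h_one h_zero bij prods by (rule domain.factorial_domainI_prime_products)
  then show ?thesis unfolding R_def .
qed
section \<open>Evaluation of polynomials\<close>

locale ring_morphism =
  fixes \<phi> :: "'a::comm_ring_1 \<Rightarrow> 'b::comm_ring_1"
  assumes add: "\<phi> (a + b) = \<phi> a + \<phi> b"
    and mult: "\<phi> (a * b) = \<phi> a * \<phi> b"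
    and one: "\<phi> 1 = 1"
begin

lemma zero: "\<phi> 0 = 0"
  using add[of 0 0] by simp

lemma uminus: "\<phi> (- a) = - \<phi> a"
  using add[of a "- a"] zero by (simp add: eq_neg_iff_add_eq_0 add.commute)

lemma diff: "\<phi> (a - b) = \<phi> a - \<phi> b"
  using add[of a "- b"] uminus by simp

lemma power: "\<phi> (a ^ n) = \<phi> a ^ n"
  by (induction n) (auto simp: one mult)

lemma of_nat: "\<phi> (of_nat n) = of_nat n"
  by (induction n) (auto simp: zero one add)

lemma numeral: "\<phi> (numeral n) = numeral n"
  using of_nat[of "numeral n"] by simp

lemmas simps = add mult one zero uminus diff power numeral

end

lemma poly_mapping_sum_single:
  fixes f :: "'m \<Rightarrow>\<^sub>0 'k::comm_monoid_add"
  shows "f = (\<Sum>m\<in>Poly_Mapping.keys f. Poly_Mapping.single m (Poly_Mapping.lookup f m))"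
  by (rule poly_mapping_eqI)
    (auto simp: lookup_sum lookup_single when_def in_keys_iff sum.delta)

lemma poly_mapping_induct_single:
  fixes f :: "'m \<Rightarrow>\<^sub>0 'k::comm_monoid_add"
  assumes "\<And>m c. P (Poly_Mapping.single m c)" and "\<And>f g. P f \<Longrightarrow> P g \<Longrightarrow> P (f + g)"
  shows "P f"
proof -
  have "P 0" using assms(1)[of _ 0] by simp
  then have "P (\<Sum>m\<in>S. Poly_Mapping.single m (Poly_Mapping.lookup f m))" for S
    using assms by (induction S rule: infinite_finite_induct) auto
  then show ?thesis using poly_mapping_sum_single[of f] by metis
qed

definition evaluate :: "('k \<Rightarrow> 'r) \<Rightarrow> ('c \<Rightarrow> 'r) \<Rightarrow> (('c::finite \<Rightarrow>\<^sub>0 nat) \<Rightarrow>\<^sub>0 'k::comm_ring_1) \<Rightarrow> 'r::comm_ring_1" where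
  "evaluate \<kappa> x f = (\<Sum>m\<in>Poly_Mapping.keys f. \<kappa> (Poly_Mapping.lookup f m) * (\<Prod>c\<in>UNIV. x c ^ Poly_Mapping.lookup m c))"

context ring_morphism
begin

lemma evaluate_superset:
  assumes "finite S" "Poly_Mapping.keys f \<subseteq> S"
  shows "evaluate \<phi> x f = (\<Sum>m\<in>S. \<phi> (Poly_Mapping.lookup f m) * (\<Prod>c\<in>UNIV. x c ^ Poly_Mapping.lookup m c))"
  unfolding evaluate_def using assms
  by (intro sum.mono_neutral_left) (auto simp: in_keys_iff zero)

lemma evaluate_add: "evaluate \<phi> x (f + g) = evaluate \<phi> x f + evaluate \<phi> x g"
proof -
  let ?S = "Poly_Mapping.keys f \<union> Poly_Mapping.keys g"
  have "evaluate \<phi> x h = (\<Sum>m\<in>?S. \<phi> (Poly_Mapping.lookup h m) * (\<Prod>c\<in>UNIV. x c ^ Poly_Mapping.lookup m c))"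
    if "h \<in> {f, g, f + g}" for h
    using that keys_add[of f g] by (intro evaluate_superset) auto
  then show ?thesis by (simp add: lookup_add add distrib_right sum.distrib)
qed

lemma evaluate_single:
  "evaluate \<phi> x (Poly_Mapping.single m a) = \<phi> a * (\<Prod>c\<in>UNIV. x c ^ Poly_Mapping.lookup m c)"
  using evaluate_superset[of "{m}" "Poly_Mapping.single m a" x] by simp

lemma evaluate_mult: "evaluate \<phi> x (f * g) = evaluate \<phi> x f * evaluate \<phi> x g"
proof (induction f rule: poly_mapping_induct_single)
  case (1 m a)
  show ?case
    by (induction g rule: poly_mapping_induct_single)
      (simp_all add: mult_single evaluate_single evaluate_add mult lookup_add power_add
        prod.distrib distrib_left mult.assoc mult.left_commute)
qed (simp add: evaluate_add distrib_right)

lemma evaluate_morphism: "ring_morphism (evaluate \<phi> x)"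
proof
  show "evaluate \<phi> x 1 = 1"
    using evaluate_single[of x 0 1] by (simp add: one)
qed (simp_all add: evaluate_add evaluate_mult)

lemma evaluate_const: "evaluate \<phi> x (Poly_Mapping.single 0 a) = \<phi> a"
  by (simp add: evaluate_single)

lemma evaluate_variable:
  "evaluate \<phi> x (Poly_Mapping.single (Poly_Mapping.single c 1) 1) = x c"
proof -
  have "(\<Prod>d\<in>UNIV. x d ^ Poly_Mapping.lookup (Poly_Mapping.single c 1) d) = (\<Prod>d\<in>UNIV. if d = c then x c else 1)"
    by (intro prod.cong) (auto simp: lookup_single when_def)
  then show ?thesis by (simp add: evaluate_single one)
qed

end

lemma single_eq_prod_variables:
  fixes m :: "'c::finite \<Rightarrow>\<^sub>0 nat"
  shows "Poly_Mapping.single m (1::'k::comm_ring_1)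
    = (\<Prod>c\<in>UNIV. Poly_Mapping.single (Poly_Mapping.single c 1) 1 ^ Poly_Mapping.lookup m c)"
proof -
  have pow: "Poly_Mapping.single (Poly_Mapping.single c 1) (1::'k) ^ n
    = Poly_Mapping.single (Poly_Mapping.single c n) 1" for c :: 'c and n
    by (induction n) (auto simp: mult_single single_add[symmetric])
  have "(\<Prod>c\<in>S. Poly_Mapping.single (Poly_Mapping.single c (Poly_Mapping.lookup m c)) (1::'k))
    = Poly_Mapping.single (\<Sum>c\<in>S. Poly_Mapping.single c (Poly_Mapping.lookup m c)) 1" if "finite S" for S
    using that by induction (auto simp: mult_single)
  moreover have "(\<Sum>c\<in>UNIV. Poly_Mapping.single c (Poly_Mapping.lookup m c)) = m"
    by (rule poly_mapping_eqI) (auto simp: lookup_sum lookup_single when_def sum.delta)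
  ultimately show ?thesis by (simp add: pow del: One_nat_def)
qed

lemma polynomial_induct [case_names const variable add mult]:
  fixes f :: "('c::finite \<Rightarrow>\<^sub>0 nat) \<Rightarrow>\<^sub>0 'k::comm_ring_1"
  assumes const: "\<And>a. P (Poly_Mapping.single 0 a)"
    and variable: "\<And>c. P (Poly_Mapping.single (Poly_Mapping.single c 1) 1)"
    and add: "\<And>f g. P f \<Longrightarrow> P g \<Longrightarrow> P (f + g)"
    and mult: "\<And>f g. P f \<Longrightarrow> P g \<Longrightarrow> P (f * g)"
  shows "P f"
proof (induction f rule: poly_mapping_induct_single)
  case (1 m a)
  have one: "P 1" using const[of 1] by simp
  have pow: "P (g ^ n)" if "P g" for g n using that one mult by (induction n) auto
  have "P (\<Prod>c\<in>S. Poly_Mapping.single (Poly_Mapping.single c 1) 1 ^ Poly_Mapping.lookup m c)" if "finite S" for S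
    using that by induction (auto intro: one mult pow variable simp del: One_nat_def)
  then have "P (Poly_Mapping.single m 1)"
    by (subst single_eq_prod_variables) simp
  then have "P (Poly_Mapping.single 0 a * Poly_Mapping.single m 1)" using mult const by blast
  then show ?case by (simp add: mult_single)
qed (rule add)

section \<open>Weights and leading exponents\<close>

definition weight_le :: "('m \<Rightarrow> int) \<Rightarrow> int \<Rightarrow> ('m \<Rightarrow>\<^sub>0 'k::zero) \<Rightarrow> bool" where
  "weight_le W n f \<longleftrightarrow> (\<forall>m\<in>Poly_Mapping.keys f. W m \<le> n)"

text \<open>\<open>e\<close> is the only exponent of maximal weight. Weights are not injective on exponents, so this
  is a condition on \<open>f\<close> and not the choice of a term order.\<close>

definition has_lead :: "('m \<Rightarrow> int) \<Rightarrow> 'm \<Rightarrow> ('m \<Rightarrow>\<^sub>0 'k::comm_ring_1) \<Rightarrow> bool" where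
  "has_lead W e f \<longleftrightarrow> (\<exists>c t. c \<noteq> 0 \<and> f = Poly_Mapping.single e c + t \<and> weight_le W (W e - 1) t)"

lemma lookup_scale: "Poly_Mapping.lookup (Poly_Mapping.single 0 c * f) e = c * Poly_Mapping.lookup f e"
  for f :: "'m::comm_monoid_add \<Rightarrow>\<^sub>0 'k::comm_ring_1"
  by (simp add: mult_map_scale_conv_mult[symmetric] map.rep_eq when_def)

lemma lead_max:
  assumes "has_lead W e f"
  shows "Poly_Mapping.lookup f e \<noteq> 0" and "m \<in> Poly_Mapping.keys f \<Longrightarrow> m \<noteq> e \<Longrightarrow> W m < W e"
proof -
  obtain c t where ct: "c \<noteq> 0" "f = Poly_Mapping.single e c + t" "weight_le W (W e - 1) t"
    using assms unfolding has_lead_def by blast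
  have "Poly_Mapping.lookup t e = 0" using ct(3) unfolding weight_le_def by (force simp: in_keys_iff)
  then show "Poly_Mapping.lookup f e \<noteq> 0" using ct by (simp add: lookup_add)
  assume "m \<in> Poly_Mapping.keys f" "m \<noteq> e"
  then have "m \<in> Poly_Mapping.keys t" using ct(2) by (auto simp: in_keys_iff lookup_add lookup_single)
  then show "W m < W e" using ct(3) unfolding weight_le_def by force
qed

text \<open>At a leading exponent of maximal weight no other member of the family can contribute.\<close>

lemma lead_independent:
  fixes F :: "'i \<Rightarrow> 'm::comm_monoid_add \<Rightarrow>\<^sub>0 'k::idom"
  assumes "finite S" and lead: "\<And>i. i \<in> S \<Longrightarrow> has_lead W (E i) (F i)" and "inj_on E S"
    and rel: "(\<Sum>i\<in>S. Poly_Mapping.single 0 (a i) * F i) = 0"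
  shows "\<forall>i\<in>S. a i = 0"
proof (rule ccontr)
  assume nz: "\<not> (\<forall>i\<in>S. a i = 0)"
  define T where "T = {i\<in>S. a i \<noteq> 0}"
  have T: "finite T" "T \<noteq> {}" using \<open>finite S\<close> nz unfolding T_def by auto
  then have "Max ((\<lambda>i. W (E i)) ` T) \<in> (\<lambda>i. W (E i)) ` T" by (intro Max_in) auto
  then obtain k where k: "k \<in> T" "W (E k) = Max ((\<lambda>i. W (E i)) ` T)" by auto
  have max: "W (E i) \<le> W (E k)" if "i \<in> T" for i using that T k by auto
  have "0 = Poly_Mapping.lookup (\<Sum>i\<in>S. Poly_Mapping.single 0 (a i) * F i) (E k)" using rel by simp
  also have "\<dots> = (\<Sum>i\<in>S. a i * Poly_Mapping.lookup (F i) (E k))" by (simp add: lookup_sum lookup_scale)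
  also have "\<dots> = (\<Sum>i\<in>{k}. a i * Poly_Mapping.lookup (F i) (E k))"
  proof (rule sum.mono_neutral_right)
    show "\<forall>i\<in>S - {k}. a i * Poly_Mapping.lookup (F i) (E k) = 0"
    proof
      fix i assume i: "i \<in> S - {k}"
      show "a i * Poly_Mapping.lookup (F i) (E k) = 0"
      proof (rule ccontr)
        assume ai: "a i * Poly_Mapping.lookup (F i) (E k) \<noteq> 0"
        then have "i \<in> T" "E k \<in> Poly_Mapping.keys (F i)" using i by (auto simp: T_def in_keys_iff)
        moreover have "E k \<noteq> E i" using inj_onD[OF \<open>inj_on E S\<close>, of k i] i k(1) unfolding T_def by auto
        ultimately have "W (E k) < W (E i)" using lead_max(2)[OF lead, of i "E k"] i by simp
        then show False using max[OF \<open>i \<in> T\<close>] by simp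
      qed
    qed
  qed (use k \<open>finite S\<close> in \<open>auto simp: T_def\<close>)
  finally show False using k(1) lead_max(1)[OF lead, of k] unfolding T_def by simp
qed

locale weight =
  fixes W :: "'m::comm_monoid_add \<Rightarrow> int"
  assumes W_add: "W (a + b) = W a + W b"
begin

lemma W_zero: "W 0 = 0"
  using W_add[of 0 0] by simp

lemma weight_le_mono: "weight_le W a f \<Longrightarrow> a \<le> b \<Longrightarrow> weight_le W b f"
  unfolding weight_le_def by force

lemma weight_le_zero: "weight_le W n 0"
  unfolding weight_le_def by simp

lemma weight_le_single: "weight_le W (W m) (Poly_Mapping.single m c)"
  unfolding weight_le_def by simp

lemma weight_le_const: "weight_le W 0 (Poly_Mapping.single 0 c)"
  unfolding weight_le_def by (simp add: W_zero)

lemma weight_le_numeral: "weight_le W 0 (numeral n :: 'm \<Rightarrow>\<^sub>0 'k::comm_ring_1)"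
  using weight_le_const[of "numeral n :: 'k"] by simp

lemma weight_le_one: "weight_le W 0 (1 :: 'm \<Rightarrow>\<^sub>0 'k::comm_ring_1)"
  using weight_le_const[of "1 :: 'k"] by simp

lemma weight_le_add:
  "weight_le W a f \<Longrightarrow> weight_le W b g \<Longrightarrow> weight_le W (max a b) (f + g)"
  for f :: "'m \<Rightarrow>\<^sub>0 'k::comm_ring_1"
  using keys_add[of f g] unfolding weight_le_def by fastforce

lemma weight_le_uminus: "weight_le W a f \<Longrightarrow> weight_le W a (- f)"
  for f :: "'m \<Rightarrow>\<^sub>0 'k::comm_ring_1"
  unfolding weight_le_def by (auto simp: in_keys_iff)

lemma weight_le_diff:
  "weight_le W a f \<Longrightarrow> weight_le W b g \<Longrightarrow> weight_le W (max a b) (f - g)"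
  for f :: "'m \<Rightarrow>\<^sub>0 'k::comm_ring_1"
  using weight_le_add[OF _ weight_le_uminus, of a f b g] by simp

lemma weight_le_mult:
  fixes f :: "'m \<Rightarrow>\<^sub>0 'k::comm_ring_1"
  assumes "weight_le W a f" "weight_le W b g"
  shows "weight_le W (a + b) (f * g)"
  unfolding weight_le_def
proof
  fix m assume "m \<in> Poly_Mapping.keys (f * g)"
  then obtain k l where "m = k + l" "k \<in> Poly_Mapping.keys f" "l \<in> Poly_Mapping.keys g"
    using keys_mult[of f g] by blast
  then show "W m \<le> a + b" using assms W_add unfolding weight_le_def by (simp add: add_mono)
qed

lemma weight_le_square: "weight_le W a f \<Longrightarrow> weight_le W (a + a) (f ^ 2)"
  for f :: "'m \<Rightarrow>\<^sub>0 'k::comm_ring_1"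
  unfolding power2_eq_square by (rule weight_le_mult)

lemmas weight_le_intros = weight_le_numeral weight_le_add weight_le_uminus weight_le_diff
  weight_le_square weight_le_mult

lemma has_lead_single: "c \<noteq> 0 \<Longrightarrow> has_lead W m (Poly_Mapping.single m c)"
  unfolding has_lead_def by (rule exI[of _ c], rule exI[of _ 0]) (simp add: weight_le_zero)

lemma has_lead_one: "has_lead W 0 (1 :: 'm \<Rightarrow>\<^sub>0 'k::idom)"
  using has_lead_single[of "1 :: 'k" 0] by simp

lemma has_leadI:
  "c \<noteq> 0 \<Longrightarrow> f = Poly_Mapping.single e c + t \<Longrightarrow> weight_le W n t \<Longrightarrow> n < W e \<Longrightarrow> has_lead W e f"
  unfolding has_lead_def using weight_le_mono[of n t "W e - 1"] by force

lemma has_lead_mult: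
  fixes f :: "'m \<Rightarrow>\<^sub>0 'k::idom"
  assumes "has_lead W e f" "has_lead W d g"
  shows "has_lead W (e + d) (f * g)"
proof -
  obtain c s where c: "c \<noteq> 0" "f = Poly_Mapping.single e c + s" "weight_le W (W e - 1) s"
    using assms(1) unfolding has_lead_def by blast
  obtain b t where b: "b \<noteq> 0" "g = Poly_Mapping.single d b + t" "weight_le W (W d - 1) t"
    using assms(2) unfolding has_lead_def by blast
  let ?r = "Poly_Mapping.single e c * t + s * (Poly_Mapping.single d b + t)"
  have "weight_le W (max (W e + (W d - 1)) (W e - 1 + max (W d) (W d - 1))) ?r"
    by (intro weight_le_add weight_le_mult weight_le_single c b)
  moreover have "f * g = Poly_Mapping.single (e + d) (c * b) + ?r"
    unfolding c(2) b(2) by (simp add: mult_single algebra_simps)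
  moreover have "max (W e + (W d - 1)) (W e - 1 + max (W d) (W d - 1)) < W (e + d)"
    using W_add[of e d] by linarith
  moreover have "c * b \<noteq> 0" using b(1) c(1) by simp
  ultimately show ?thesis using has_leadI by blast
qed

end

section \<open>Nested univariate polynomials inside Laurent polynomials\<close>

text \<open>Univariate polynomials over a factorial ring form a factorial ring. The polynomial ring in
  the variables \<open>V\<close> is therefore represented by an iterated univariate polynomial type \<open>'q\<close>, which
  \<open>j\<close> embeds into the Laurent polynomials. Its image is pinned down from both sides: it contains
  the constants and the variables in \<open>V\<close>, and only nonnegative exponents at \<open>V\<close> occur in it.\<close>

locale polynomial_model = ring_morphism j
  for j :: "'q::idom \<Rightarrow> ('c::linorder \<Rightarrow>\<^sub>0 int) \<Rightarrow>\<^sub>0 'k::idom" +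
  fixes V :: "'c set"
  assumes kernel: "j q = 0 \<Longrightarrow> q = 0"
    and support: "m \<in> Poly_Mapping.keys (j q) \<Longrightarrow> c \<notin> V \<Longrightarrow> Poly_Mapping.lookup m c = 0"
    and nonneg: "m \<in> Poly_Mapping.keys (j q) \<Longrightarrow> 0 \<le> Poly_Mapping.lookup m c"
    and constants: "Poly_Mapping.single 0 a \<in> range j"
    and variables: "c \<in> V \<Longrightarrow> Poly_Mapping.single (Poly_Mapping.single c 1) 1 \<in> range j"

lemma polynomial_model_constants:
  "polynomial_model (Poly_Mapping.single 0 :: 'k::idom \<Rightarrow> ('c::linorder \<Rightarrow>\<^sub>0 int) \<Rightarrow>\<^sub>0 'k) {}"
proof
  show "Poly_Mapping.single (0 :: 'c \<Rightarrow>\<^sub>0 int) a = 0 \<Longrightarrow> a = 0" for a :: 'k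
    using lookup_single_eq[of "0 :: 'c \<Rightarrow>\<^sub>0 int" a] by simp
qed (auto simp: single_add mult_single split: if_splits)

definition adjoin :: "('q::idom \<Rightarrow> ('c::linorder \<Rightarrow>\<^sub>0 int) \<Rightarrow>\<^sub>0 'k::idom) \<Rightarrow> 'c \<Rightarrow> 'q poly
    \<Rightarrow> ('c \<Rightarrow>\<^sub>0 int) \<Rightarrow>\<^sub>0 'k" where
  "adjoin j c p = poly (map_poly j p) (Poly_Mapping.single (Poly_Mapping.single c 1) 1)"

context polynomial_model
begin

lemma adjoin_pCons:
  "adjoin j c (pCons a p) = j a + Poly_Mapping.single (Poly_Mapping.single c 1) 1 * adjoin j c p"
  unfolding adjoin_def by (simp add: map_poly_pCons zero)

lemma adjoin_zero: "adjoin j c 0 = 0"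
  unfolding adjoin_def by simp

lemma adjoin_add: "adjoin j c (p + q) = adjoin j c p + adjoin j c q"
  by (induction p q rule: poly_induct2) (auto simp: adjoin_pCons adjoin_zero add algebra_simps)

lemma adjoin_smult: "adjoin j c (smult a p) = j a * adjoin j c p"
  by (induction p) (auto simp: adjoin_pCons adjoin_zero mult algebra_simps)

lemma adjoin_mult: "adjoin j c (p * q) = adjoin j c p * adjoin j c q"
  by (induction p) (auto simp: adjoin_pCons adjoin_zero adjoin_add adjoin_smult zero algebra_simps)

lemma adjoin_keys:
  assumes "m \<in> Poly_Mapping.keys (adjoin j c p)"
  shows "0 \<le> Poly_Mapping.lookup m d \<and> (d \<notin> insert c V \<longrightarrow> Poly_Mapping.lookup m d = 0)"
  using assms
proof (induction p arbitrary: m)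
  case 0
  then show ?case by (simp add: adjoin_zero)
next
  case (pCons a p)
  let ?x = "Poly_Mapping.single (Poly_Mapping.single c 1) 1 :: ('c \<Rightarrow>\<^sub>0 int) \<Rightarrow>\<^sub>0 'k"
  from pCons.prems have "m \<in> Poly_Mapping.keys (j a) \<or> m \<in> Poly_Mapping.keys (?x * adjoin j c p)"
    unfolding adjoin_pCons using keys_add[of "j a" "?x * adjoin j c p"] by blast
  then show ?case
  proof
    assume "m \<in> Poly_Mapping.keys (j a)"
    then show ?thesis using nonneg support by auto
  next
    assume "m \<in> Poly_Mapping.keys (?x * adjoin j c p)"
    then obtain n where "m = Poly_Mapping.single c 1 + n" "n \<in> Poly_Mapping.keys (adjoin j c p)"
      using keys_mult[of ?x "adjoin j c p"] by auto
    then show ?thesis using pCons.IH[of n] by (auto simp: lookup_add lookup_single when_def)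
  qed
qed

text \<open>The constant term involves only exponents that vanish at \<open>c\<close>, the remaining part only
  exponents that are positive there, so they cannot cancel.\<close>

lemma adjoin_kernel:
  assumes "c \<notin> V"
  shows "adjoin j c p = 0 \<Longrightarrow> p = 0"
proof (induction p)
  case (pCons a p)
  let ?x = "Poly_Mapping.single (Poly_Mapping.single c 1) 1 :: ('c \<Rightarrow>\<^sub>0 int) \<Rightarrow>\<^sub>0 'k"
  have eq: "?x * adjoin j c p = - j a"
    using pCons.prems unfolding adjoin_pCons by (simp add: eq_neg_iff_add_eq_0 add.commute)
  have "Poly_Mapping.keys (j a) = {}"
  proof (rule ccontr)
    assume "Poly_Mapping.keys (j a) \<noteq> {}"
    then obtain m where m: "m \<in> Poly_Mapping.keys (j a)" by blast
    then have "m \<in> Poly_Mapping.keys (?x * adjoin j c p)" unfolding eq by (simp add: in_keys_iff)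
    then obtain n where n: "m = Poly_Mapping.single c 1 + n" "n \<in> Poly_Mapping.keys (adjoin j c p)"
      using keys_mult[of ?x "adjoin j c p"] by auto
    then have "Poly_Mapping.lookup m c \<ge> 1" using adjoin_keys[OF n(2), of c] by (simp add: lookup_add)
    then show False using support[OF m assms] by simp
  qed
  then have "j a = 0" by simp
  moreover have "?x \<noteq> 0"
    using lookup_single_eq[of "Poly_Mapping.single c (1::int)" "1 :: 'k"] by (metis lookup_zero zero_neq_one)
  ultimately have "adjoin j c p = 0" using eq by simp
  then show ?case using pCons.IH kernel[OF \<open>j a = 0\<close>] by simp
qed simp

theorem adjoin_model:
  assumes "c \<notin> V"
  shows "polynomial_model (adjoin j c) (insert c V)"
proof -
  have const: "adjoin j c [:a:] = j a" for a by (simp add: adjoin_pCons adjoin_zero)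
  have var: "adjoin j c [:0, 1:] = Poly_Mapping.single (Poly_Mapping.single c 1) 1"
    by (simp add: adjoin_pCons adjoin_zero zero one)
  have sub: "range j \<subseteq> range (adjoin j c)" using const by (metis image_subsetI rangeI)
  show ?thesis
  proof
    show "adjoin j c 1 = 1" using const[of 1] by (simp add: one one_pCons)
    show "Poly_Mapping.single 0 a \<in> range (adjoin j c)" for a using constants sub by blast
    show "Poly_Mapping.single (Poly_Mapping.single d 1) 1 \<in> range (adjoin j c)" if "d \<in> insert c V" for d
      using that variables sub var by (metis insert_iff rangeI subsetD)
  qed (use adjoin_add adjoin_mult adjoin_kernel[OF assms] adjoin_keys in auto)
qed

lemma adjoin_in:
  assumes "\<And>q. j q \<in> A" "Poly_Mapping.single (Poly_Mapping.single c 1) 1 \<in> A"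
    and "\<And>a b. a \<in> A \<Longrightarrow> b \<in> A \<Longrightarrow> a + b \<in> A" "\<And>a b. a \<in> A \<Longrightarrow> b \<in> A \<Longrightarrow> a * b \<in> A"
  shows "adjoin j c p \<in> A"
proof (induction p)
  case 0
  show ?case using assms(1)[of 0] by (simp add: adjoin_zero zero)
qed (use assms in \<open>auto simp: adjoin_pCons\<close>)

end
section \<open>The embedding into Laurent polynomials\<close>

lemma UNIV_coord:
  "(UNIV :: coord set) = {U, X1, X2, Y1, Y2, P1, P2, P3, P4, Z, S1, S2, S3, S4, T1, T2, T3, T4}"
proof -
  have "c \<in> {U, X1, X2, Y1, Y2, P1, P2, P3, P4, Z, S1, S2, S3, S4, T1, T2, T3, T4}" for c
    by (cases c) auto
  then show ?thesis by blast
qed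

instance coord :: finite
  by standard (simp add: UNIV_coord)

instantiation coord :: linorder
begin

text \<open>Any linear order will do: it makes the exponents a linearly ordered group, and so the
  polynomials and Laurent polynomials an integral domain.\<close>

definition less_eq_coord :: "coord \<Rightarrow> coord \<Rightarrow> bool" where
  "less_eq_coord c d \<longleftrightarrow> to_nat c \<le> to_nat d"

definition less_coord :: "coord \<Rightarrow> coord \<Rightarrow> bool" where
  "less_coord c d \<longleftrightarrow> to_nat c < to_nat d"

instance
  by standard (auto simp: less_eq_coord_def less_coord_def)

end

type_synonym laurent = "(coord \<Rightarrow>\<^sub>0 int) \<Rightarrow>\<^sub>0 complex"

text \<open>\<open>u_times_p1\<close>, ..., \<open>u_times_p4\<close> are what the first four equations say about \<open>u * p1\<close>, ...,
  \<open>u * p4\<close>, for arbitrary values of the coordinates.\<close>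

definition u_times_p1 :: "(coord \<Rightarrow> 'r::comm_ring_1) \<Rightarrow> 'r" where
  "u_times_p1 v = - ((v X1)^2 * (v S1 * v T2 - v S2 * v T1) + 2 * v X1 * v X2 * (v S1 * v T3 - v S3 * v T1)
    + (v X2)^2 * (v S1 * v T4 - v S4 * v T1) + 2 * v X1 * v Y1 * (v S2 * v T3 - v S3 * v T2)
    + (v X1 * v Y2 + v X2 * v Y1) * (v S2 * v T4 - v S4 * v T2)
    + 2 * v X2 * v Y2 * (v S3 * v T4 - v S4 * v T3))"

definition u_times_p2 :: "(coord \<Rightarrow> 'r::comm_ring_1) \<Rightarrow> 'r" where
  "u_times_p2 v = v T1 * (v X2 * v Y1 - v X1 * v Y2) + v T2 * ((v Y1)^2 - v Z * (v X1)^2)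
    + 2 * v T3 * (v Y1 * v Y2 - v Z * v X1 * v X2) + v T4 * ((v Y2)^2 - v Z * (v X2)^2)"

definition u_times_p3 :: "(coord \<Rightarrow> 'r::comm_ring_1) \<Rightarrow> 'r" where
  "u_times_p3 v = v X1 * v Y1 * (v S1 * v T2 - v S2 * v T1)
    + (v X1 * v Y2 + v X2 * v Y1) * (v S1 * v T3 - v S3 * v T1)
    + v X2 * v Y2 * (v S1 * v T4 - v S4 * v T1) + ((v Y1)^2 + v Z * (v X1)^2) * (v S2 * v T3 - v S3 * v T2)
    + (v Y1 * v Y2 + v Z * v X1 * v X2) * (v S2 * v T4 - v S4 * v T2)
    + ((v Y2)^2 + v Z * (v X2)^2) * (v S3 * v T4 - v S4 * v T3)"

definition u_times_p4 :: "(coord \<Rightarrow> 'r::comm_ring_1) \<Rightarrow> 'r" where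
  "u_times_p4 v = v S1 * (v X2 * v Y1 - v X1 * v Y2) + v S2 * ((v Y1)^2 - v Z * (v X1)^2)
    + 2 * v S3 * (v Y1 * v Y2 - v Z * v X1 * v X2) + v S4 * ((v Y2)^2 - v Z * (v X2)^2)"

definition lvar :: "coord \<Rightarrow> laurent" where
  "lvar c = Poly_Mapping.single (Poly_Mapping.single c 1) 1"

definition u_inv :: laurent where
  "u_inv = Poly_Mapping.single (Poly_Mapping.single U (- 1)) 1"

lemma u_inv_times_u: "u_inv * lvar U = 1"
  by (simp add: u_inv_def lvar_def mult_single single_add[symmetric])

definition image :: "coord \<Rightarrow> laurent" where
  "image c = (case c of P1 \<Rightarrow> u_inv * u_times_p1 lvar | P2 \<Rightarrow> u_inv * u_times_p2 lvar
    | P3 \<Rightarrow> u_inv * u_times_p3 lvar | P4 \<Rightarrow> u_inv * u_times_p4 lvar | _ \<Rightarrow> lvar c)"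

definition Phi :: "upsilon_poly \<Rightarrow> laurent" where
  "Phi = evaluate (Poly_Mapping.single 0) image"

lemma single_zero_morphism: "ring_morphism (Poly_Mapping.single (0::'m::comm_monoid_add) :: 'k::comm_ring_1 \<Rightarrow> _)"
  by standard (auto simp: single_add mult_single)

interpretation const: ring_morphism "Poly_Mapping.single (0::coord \<Rightarrow>\<^sub>0 int) :: complex \<Rightarrow> laurent"
  by (rule single_zero_morphism)

interpretation Phi: ring_morphism Phi
  unfolding Phi_def by (rule const.evaluate_morphism)

lemma Phi_var: "Phi (var c) = image c"
  unfolding Phi_def var_def by (rule const.evaluate_variable)

lemma Phi_const: "Phi (Poly_Mapping.single 0 a) = Poly_Mapping.single 0 a"
  unfolding Phi_def by (rule const.evaluate_const)

lemmas sharp_defs = p1_sharp_def p2_sharp_def p3_sharp_def p4_sharp_def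
  x1_sharp_def x2_sharp_def y1_sharp_def y2_sharp_def u_sharp_def

abbreviation upsilon_generators :: "upsilon_poly set" where
  "upsilon_generators \<equiv>
     {p1_sharp, p2_sharp, p3_sharp, p4_sharp, x1_sharp, x2_sharp, y1_sharp, y2_sharp, u_sharp}"

lemma upsilon_ideal: "ideal upsilon_ideal upsilon_poly_ring"
proof -
  interpret ring upsilon_poly_ring
    unfolding upsilon_poly_ring_def using cring_from_type_algebra cring.axioms(1) by blast
  show ?thesis
    unfolding upsilon_ideal_def
    by (rule genideal_ideal) (simp add: upsilon_poly_ring_def ring_of_type_algebra_def)
qed

lemma ideal_generator: "g \<in> upsilon_generators \<Longrightarrow> g \<in> upsilon_ideal"
proof -
  interpret ring upsilon_poly_ring
    unfolding upsilon_poly_ring_def using cring_from_type_algebra cring.axioms(1) by blast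
  have "upsilon_generators \<subseteq> upsilon_ideal"
    unfolding upsilon_ideal_def
    by (rule genideal_self) (simp add: upsilon_poly_ring_def ring_of_type_algebra_def)
  then show "g \<in> upsilon_generators \<Longrightarrow> g \<in> upsilon_ideal" by blast
qed

lemma ideal_add: "f \<in> upsilon_ideal \<Longrightarrow> g \<in> upsilon_ideal \<Longrightarrow> f + g \<in> upsilon_ideal"
  using additive_subgroup.a_closed[OF ideal.axioms(1)[OF upsilon_ideal], of f g]
  by (simp add: upsilon_poly_ring_def ring_of_type_algebra_def)

lemma ideal_mult: "f \<in> upsilon_ideal \<Longrightarrow> g * f \<in> upsilon_ideal"
  using ideal.I_l_closed[OF upsilon_ideal, of f g]
  by (simp add: upsilon_poly_ring_def ring_of_type_algebra_def)

lemma ideal_zero: "0 \<in> upsilon_ideal"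
  using ideal_mult[OF ideal_generator[of u_sharp], of 0] by simp

lemma morphism_kills_ideal:
  fixes \<phi> :: "upsilon_poly \<Rightarrow> 'r::comm_ring_1"
  assumes "ring_morphism \<phi>" and gens: "\<And>g. g \<in> upsilon_generators \<Longrightarrow> \<phi> g = 0"
    and f: "f \<in> upsilon_ideal"
  shows "\<phi> f = 0"
proof -
  interpret \<phi>: ring_morphism \<phi> by fact
  have "ring upsilon_poly_ring" "ring (ring_of_type_algebra :: 'r ring)"
    unfolding upsilon_poly_ring_def using cring_from_type_algebra cring.axioms(1) by blast+
  then interpret hom: ring_hom_ring upsilon_poly_ring "ring_of_type_algebra :: 'r ring" \<phi>
    by (intro ring_hom_ringI)
      (auto simp: upsilon_poly_ring_def ring_of_type_algebra_def \<phi>.simps)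
  have "upsilon_generators \<subseteq> a_kernel upsilon_poly_ring ring_of_type_algebra \<phi>"
    using gens unfolding a_kernel_def'
    by (auto simp: upsilon_poly_ring_def ring_of_type_algebra_def)
  then have "upsilon_ideal \<subseteq> a_kernel upsilon_poly_ring ring_of_type_algebra \<phi>"
    unfolding upsilon_ideal_def by (rule hom.R.genideal_minimal[OF hom.kernel_is_ideal])
  then show ?thesis
    using f unfolding a_kernel_def' by (auto simp: ring_of_type_algebra_def)
qed

text \<open>The four middle equations say \<open>M X = p1 Y + p3 X\<close> and \<open>M Y = e X - p3 Y\<close> for
  \<open>X = (x1, x2)\<close>, \<open>Y = (y1, y2)\<close>, \<open>e = p2 s1 - p4 t1 - z p1\<close> and a traceless matrix \<open>M\<close>.
  Hence \<open>M\<^sup>2 X = (p1 e + p3\<^sup>2) X\<close>, while \<open>M\<^sup>2\<close> is a scalar; comparing the two scalars gives the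
  last equation up to the factor \<open>x1\<close>.\<close>

lemma x1_times_u_sharp:
  "var X1 * u_sharp = - ((var P2 * var S3 - var P4 * var T3) + var P3) * x1_sharp
    - (var P2 * var S4 - var P4 * var T4) * x2_sharp + var P1 * y1_sharp"
  unfolding u_sharp_def x1_sharp_def x2_sharp_def y1_sharp_def
  by (simp add: algebra_simps power2_eq_square)

lemma kills_u_sharp:
  fixes \<psi> :: "upsilon_poly \<Rightarrow> 'r::idom"
  assumes "ring_morphism \<psi>" "\<psi> (var X1) \<noteq> 0" "\<psi> x1_sharp = 0" "\<psi> x2_sharp = 0" "\<psi> y1_sharp = 0"
  shows "\<psi> u_sharp = 0"
proof -
  interpret \<psi>: ring_morphism \<psi> by fact
  have "\<psi> (var X1) * \<psi> u_sharp = 0"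
    unfolding \<psi>.mult[symmetric] x1_times_u_sharp using assms by (simp add: \<psi>.simps)
  then show ?thesis using assms by simp
qed

text \<open>Multiplied by \<open>u\<close>, the four middle equations become identities between the polynomials
  \<open>u * p1\<close>, ..., \<open>u * p4\<close> of the first four.\<close>

lemma middle_equations:
  fixes v :: "coord \<Rightarrow> 'r::comm_ring_1"
  shows "- u_times_p1 v * v Y1 - u_times_p3 v * v X1
      + (u_times_p2 v * v S3 - u_times_p4 v * v T3) * v X1
      + (u_times_p2 v * v S4 - u_times_p4 v * v T4) * v X2 = 0" (is ?x1)
    and "- u_times_p1 v * v Y2 - u_times_p3 v * v X2
      - (u_times_p2 v * v S2 - u_times_p4 v * v T2) * v X1
      - (u_times_p2 v * v S3 - u_times_p4 v * v T3) * v X2 = 0" (is ?x2)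
    and "(- v Z * u_times_p1 v + u_times_p2 v * v S1 - u_times_p4 v * v T1) * v X1
      - u_times_p3 v * v Y1 - (u_times_p2 v * v S3 - u_times_p4 v * v T3) * v Y1
      - (u_times_p2 v * v S4 - u_times_p4 v * v T4) * v Y2 = 0" (is ?y1)
    and "(- v Z * u_times_p1 v + u_times_p2 v * v S1 - u_times_p4 v * v T1) * v X2
      - u_times_p3 v * v Y2 + (u_times_p2 v * v S2 - u_times_p4 v * v T2) * v Y1
      + (u_times_p2 v * v S3 - u_times_p4 v * v T3) * v Y2 = 0" (is ?y2)
proof -
  note defs = u_times_p1_def u_times_p2_def u_times_p3_def u_times_p4_def
  show ?x1 unfolding defs by (simp add: algebra_simps power2_eq_square)
  show ?x2 unfolding defs by (simp add: algebra_simps power2_eq_square)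
  show ?y1 unfolding defs by (simp add: algebra_simps power2_eq_square)
  show ?y2 unfolding defs by (simp add: algebra_simps power2_eq_square)
qed

lemma substitution_kills:
  fixes v :: "coord \<Rightarrow> 'r::idom" and \<phi> :: "upsilon_poly \<Rightarrow> 'r"
  assumes "ring_morphism \<phi>" and v: "\<And>c. \<phi> (var c) = v c"
    and nonzero: "v U \<noteq> 0" "v X1 \<noteq> 0"
    and up: "v U * v P1 = u_times_p1 v" "v U * v P2 = u_times_p2 v"
      "v U * v P3 = u_times_p3 v" "v U * v P4 = u_times_p4 v"
    and g: "g \<in> upsilon_generators"
  shows "\<phi> g = 0"
proof -
  interpret \<phi>: ring_morphism \<phi> by fact
  have first: "\<phi> p1_sharp = 0" "\<phi> p2_sharp = 0" "\<phi> p3_sharp = 0" "\<phi> p4_sharp = 0"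
    using up by (simp_all add: sharp_defs \<phi>.simps v u_times_p1_def u_times_p2_def
        u_times_p3_def u_times_p4_def)
  note m = middle_equations[of v, unfolded up[symmetric]]
  have "v U * \<phi> x1_sharp = 0"
    by (rule trans[OF _ m(1)]) (simp add: sharp_defs \<phi>.simps v algebra_simps)
  moreover have "v U * \<phi> x2_sharp = 0"
    by (rule trans[OF _ m(2)]) (simp add: sharp_defs \<phi>.simps v algebra_simps)
  moreover have "v U * \<phi> y1_sharp = 0"
    by (rule trans[OF _ m(3)]) (simp add: sharp_defs \<phi>.simps v algebra_simps)
  moreover have "v U * \<phi> y2_sharp = 0"
    by (rule trans[OF _ m(4)]) (simp add: sharp_defs \<phi>.simps v algebra_simps)
  ultimately have middle: "\<phi> x1_sharp = 0" "\<phi> x2_sharp = 0" "\<phi> y1_sharp = 0" "\<phi> y2_sharp = 0"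
    using nonzero by simp_all
  have "\<phi> u_sharp = 0"
    using kills_u_sharp[OF \<phi>.ring_morphism_axioms] middle nonzero v by simp
  then show ?thesis using first middle g by (elim insertE) simp_all
qed

lemma Phi_kills_ideal: "f \<in> upsilon_ideal \<Longrightarrow> Phi f = 0"
proof (rule morphism_kills_ideal[OF Phi.ring_morphism_axioms])
  have lvar: "u_times_p1 image = u_times_p1 lvar" "u_times_p2 image = u_times_p2 lvar"
    "u_times_p3 image = u_times_p3 lvar" "u_times_p4 image = u_times_p4 lvar"
    by (simp_all add: u_times_p1_def u_times_p2_def u_times_p3_def u_times_p4_def image_def)
  have up: "image U * image P1 = u_times_p1 image" "image U * image P2 = u_times_p2 image"
    "image U * image P3 = u_times_p3 image" "image U * image P4 = u_times_p4 image"
    unfolding lvar using u_inv_times_u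
    by (simp_all add: image_def mult.assoc[symmetric] mult.commute[of "lvar U"])
  have "lvar c \<noteq> 0" for c
    using lookup_single_eq[of "Poly_Mapping.single c (1::int)" "1 :: complex"]
    unfolding lvar_def by (metis lookup_zero zero_neq_one)
  then have nonzero: "image U \<noteq> 0" "image X1 \<noteq> 0" by (simp_all add: image_def)
  show "Phi g = 0" if "g \<in> upsilon_generators" for g
    using substitution_kills[OF Phi.ring_morphism_axioms Phi_var nonzero up that] .
qed
section \<open>Straightening modulo the ideal\<close>

text \<open>The weights make one monomial of each of the nine generators strictly heavier than the others
  (lemmas \<open>leading_term_p1\<close> to \<open>leading_term_u\<close>), so that rewriting it by the rest of the generator
  terminates.\<close>

definition straightening_weight :: "coord \<Rightarrow> int" where
  "straightening_weight c = (case c of X1 \<Rightarrow> 1 | Y1 \<Rightarrow> 3 | Y2 \<Rightarrow> 3 | P1 \<Rightarrow> 2 | P3 \<Rightarrow> 3 | S2 \<Rightarrow> 1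
     | T1 \<Rightarrow> 3 | _ \<Rightarrow> 0)"

definition monomial_weight :: "(coord \<Rightarrow>\<^sub>0 nat) \<Rightarrow> int" where
  "monomial_weight m = (\<Sum>c\<in>UNIV. straightening_weight c * int (Poly_Mapping.lookup m c))"

interpretation monomial: weight monomial_weight
  by standard (simp add: monomial_weight_def lookup_add distrib_left sum.distrib)

lemma monomial_weight_single:
  "monomial_weight (Poly_Mapping.single c n) = straightening_weight c * int n"
proof -
  have "monomial_weight (Poly_Mapping.single c n)
      = (\<Sum>d\<in>UNIV. if d = c then straightening_weight c * int n else 0)"
    unfolding monomial_weight_def by (intro sum.cong) (auto simp: lookup_single when_def)
  then show ?thesis by simp
qed

lemma monomial_weight_nonneg: "0 \<le> monomial_weight m"
proof -
  have "0 \<le> straightening_weight c" for c by (cases c) (simp_all add: straightening_weight_def)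
  then show ?thesis unfolding monomial_weight_def by (intro sum_nonneg) simp
qed

lemma monomial_weight_var: "weight_le monomial_weight (straightening_weight c) (var c)"
  using monomial.weight_le_single[of "Poly_Mapping.single c 1" 1]
  by (simp add: var_def monomial_weight_single)

text \<open>The monomials divisible by none of the leading monomials, with respect to
  \<open>monomial_weight\<close>, of the nine generators.\<close>

definition standard :: "(coord \<Rightarrow>\<^sub>0 nat) \<Rightarrow> bool" where
  "standard m \<longleftrightarrow> (let e = Poly_Mapping.lookup m in
     \<not> (2 \<le> e X1 \<and> 1 \<le> e S2 \<and> 1 \<le> e T1) \<and>
     \<not> (1 \<le> e X1 \<and> 1 \<le> e Y2 \<and> 1 \<le> e T1) \<and>
     \<not> (1 \<le> e X1 \<and> 1 \<le> e Y1 \<and> 1 \<le> e S2 \<and> 1 \<le> e T1) \<and>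
     \<not> (2 \<le> e Y1 \<and> 1 \<le> e S2) \<and>
     \<not> (1 \<le> e Y1 \<and> 1 \<le> e P1) \<and>
     \<not> (1 \<le> e Y2 \<and> 1 \<le> e P1) \<and>
     \<not> (1 \<le> e Y1 \<and> 1 \<le> e P3) \<and>
     \<not> (1 \<le> e Y2 \<and> 1 \<le> e P3) \<and>
     \<not> (2 \<le> e P3))"

definition standard_sum :: "upsilon_poly \<Rightarrow> bool" where
  "standard_sum f \<longleftrightarrow> (\<forall>m\<in>Poly_Mapping.keys f. standard m)"

definition straightens :: "upsilon_poly \<Rightarrow> bool" where
  "straightens f \<longleftrightarrow> (\<exists>s. standard_sum s \<and> f - s \<in> upsilon_ideal)"

lemma standard_sum_zero: "standard_sum 0"
  by (simp add: standard_sum_def)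

lemma standard_sum_add: "standard_sum f \<Longrightarrow> standard_sum g \<Longrightarrow> standard_sum (f + g)"
  unfolding standard_sum_def using keys_add[of f g] by blast

lemma straightens_add: "straightens f \<Longrightarrow> straightens g \<Longrightarrow> straightens (f + g)"
proof -
  assume "straightens f" "straightens g"
  then obtain s t where "standard_sum s" "f - s \<in> upsilon_ideal" "standard_sum t" "g - t \<in> upsilon_ideal"
    unfolding straightens_def by blast
  then have "standard_sum (s + t)" "f + g - (s + t) \<in> upsilon_ideal"
    using standard_sum_add[of s t] ideal_add[of "f - s" "g - t"] by (simp_all add: algebra_simps)
  then show ?thesis unfolding straightens_def by blast
qed

lemma straightens_ideal: "f \<in> upsilon_ideal \<Longrightarrow> straightens f"
  unfolding straightens_def using standard_sum_zero by (intro exI[of _ 0]) simp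

lemma straightens_terms:
  assumes "\<And>m. m \<in> Poly_Mapping.keys f \<Longrightarrow> straightens (Poly_Mapping.single m (Poly_Mapping.lookup f m))"
  shows "straightens f"
proof -
  have "straightens (\<Sum>m\<in>S. Poly_Mapping.single m (Poly_Mapping.lookup f m))"
    if "finite S" "S \<subseteq> Poly_Mapping.keys f" for S
    using that
  proof induction
    case empty
    show ?case using straightens_ideal[OF ideal_zero] by simp
  next
    case (insert m S)
    then show ?case using straightens_add[OF assms[of m]] by simp
  qed
  from this[of "Poly_Mapping.keys f"] show ?thesis
    by (simp add: poly_mapping_sum_single[symmetric])
qed

definition leading_term :: "upsilon_poly \<Rightarrow> (coord \<Rightarrow>\<^sub>0 nat) \<Rightarrow> complex \<Rightarrow> bool" where
  "leading_term g e a \<longleftrightarrow> g \<in> upsilon_ideal \<and> a \<noteq> 0 \<and>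
     weight_le monomial_weight (monomial_weight e - 1) (g - Poly_Mapping.single e a)"

lemma leading_termI:
  assumes "g \<in> upsilon_generators" "a \<noteq> 0" "g = Poly_Mapping.single e a + t"
    "weight_le monomial_weight n t" "n \<le> monomial_weight e - 1"
  shows "leading_term g e a"
proof -
  have "g - Poly_Mapping.single e a = t" using assms(3) by simp
  then show ?thesis
    unfolding leading_term_def
    using ideal_generator[OF assms(1)] monomial.weight_le_mono[OF assms(4,5)] assms(2) by simp
qed

lemma straightens_reduce:
  assumes g: "leading_term g e a" and e: "\<And>c. Poly_Mapping.lookup e c \<le> Poly_Mapping.lookup m c"
    and smaller: "\<And>k b. monomial_weight k < monomial_weight m \<Longrightarrow> straightens (Poly_Mapping.single k b)"
  shows "straightens (Poly_Mapping.single m b)"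
proof -
  define r where "r = Poly_Mapping.single (m - e) (b / a)"
  have "m - e + e = m" by (rule poly_mapping_eqI) (use e in \<open>simp add: lookup_add lookup_minus\<close>)
  moreover from this have W: "monomial_weight m = monomial_weight (m - e) + monomial_weight e"
    using monomial.W_add by metis
  ultimately have "Poly_Mapping.single m b = r * Poly_Mapping.single e a"
    using g unfolding r_def leading_term_def by (simp add: mult_single)
  then have split: "Poly_Mapping.single m b = r * g + r * (Poly_Mapping.single e a - g)"
    by (simp add: algebra_simps)
  have "weight_le monomial_weight (monomial_weight e - 1) (- (g - Poly_Mapping.single e a))"
    using g monomial.weight_le_uminus unfolding leading_term_def by blast
  then have "weight_le monomial_weight (monomial_weight (m - e) + (monomial_weight e - 1))
      (r * (Poly_Mapping.single e a - g))"
    unfolding r_def by (intro monomial.weight_le_mult monomial.weight_le_single) simp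
  then have "straightens (r * (Poly_Mapping.single e a - g))"
    using W by (auto intro!: straightens_terms[OF smaller] simp: weight_le_def)
  moreover have "straightens (r * g)"
    using g ideal_mult straightens_ideal unfolding leading_term_def by blast
  ultimately show ?thesis unfolding split using straightens_add by blast
qed

lemma single_one_mult:
  "Poly_Mapping.single (m + n) (1::'k::comm_ring_1) = Poly_Mapping.single m 1 * Poly_Mapping.single n 1"
  by (simp add: mult_single)

lemma single_var: "Poly_Mapping.single (Poly_Mapping.single c (Suc 0)) 1 = var c"
  by (simp add: var_def)

lemma single_var_square: "Poly_Mapping.single (Poly_Mapping.single c 2) 1 = var c ^ 2"
  by (simp add: var_def power2_eq_square mult_single single_add[symmetric] numeral_2_eq_2)

lemmas expand_monomial = single_one_mult single_var single_var_square single_uminus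

lemma leading_term_p1:
  "leading_term p1_sharp (Poly_Mapping.single X1 2 + Poly_Mapping.single S2 1 + Poly_Mapping.single T1 1) 1"
  by (rule leading_termI[where t = "- var U * var P1 - ((var X1)^2 * (var S1 * var T2) + 2 * var X1 * var X2 * (var S1 * var T3 - var S3 * var T1)
    + (var X2)^2 * (var S1 * var T4 - var S4 * var T1) + 2 * var X1 * var Y1 * (var S2 * var T3 - var S3 * var T2)
    + (var X1 * var Y2 + var X2 * var Y1) * (var S2 * var T4 - var S4 * var T2) + 2 * var X2 * var Y2 * (var S3 * var T4 - var S4 * var T3))"],
      simp, simp, simp add: p1_sharp_def expand_monomial algebra_simps,
      ((rule monomial_weight_var monomial.weight_le_intros)+)[1],
      simp add: straightening_weight_def monomial.W_add monomial_weight_single)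

lemma leading_term_p2:
  "leading_term p2_sharp (Poly_Mapping.single X1 1 + Poly_Mapping.single Y2 1 + Poly_Mapping.single T1 1) (- 1)"
  by (rule leading_termI[where t = "- var U * var P2 + var T1 * (var X2 * var Y1) + var T2 * ((var Y1)^2 - var Z * (var X1)^2)
    + 2 * var T3 * (var Y1 * var Y2 - var Z * var X1 * var X2) + var T4 * ((var Y2)^2 - var Z * (var X2)^2)"],
      simp, simp, simp add: p2_sharp_def expand_monomial algebra_simps,
      ((rule monomial_weight_var monomial.weight_le_intros)+)[1],
      simp add: straightening_weight_def monomial.W_add monomial_weight_single)

lemma leading_term_p3:
  "leading_term p3_sharp (Poly_Mapping.single X1 1 + Poly_Mapping.single Y1 1 + Poly_Mapping.single S2 1 + Poly_Mapping.single T1 1) 1"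
  by (rule leading_termI[where t = "var U * var P3 - (var X1 * var Y1 * (var S1 * var T2)
    + (var X1 * var Y2 + var X2 * var Y1) * (var S1 * var T3 - var S3 * var T1) + var X2 * var Y2 * (var S1 * var T4 - var S4 * var T1)
    + ((var Y1)^2 + var Z * (var X1)^2) * (var S2 * var T3 - var S3 * var T2)
    + (var Y1 * var Y2 + var Z * var X1 * var X2) * (var S2 * var T4 - var S4 * var T2)
    + ((var Y2)^2 + var Z * (var X2)^2) * (var S3 * var T4 - var S4 * var T3))"],
      simp, simp, simp add: p3_sharp_def expand_monomial algebra_simps,
      ((rule monomial_weight_var monomial.weight_le_intros)+)[1],
      simp add: straightening_weight_def monomial.W_add monomial_weight_single)

lemma leading_term_p4:
  "leading_term p4_sharp (Poly_Mapping.single Y1 2 + Poly_Mapping.single S2 1) 1"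
  by (rule leading_termI[where t = "- var U * var P4 + var S1 * (var X2 * var Y1 - var X1 * var Y2) - var S2 * (var Z * (var X1)^2)
    + 2 * var S3 * (var Y1 * var Y2 - var Z * var X1 * var X2) + var S4 * ((var Y2)^2 - var Z * (var X2)^2)"],
      simp, simp, simp add: p4_sharp_def expand_monomial algebra_simps,
      ((rule monomial_weight_var monomial.weight_le_intros)+)[1],
      simp add: straightening_weight_def monomial.W_add monomial_weight_single)

lemma leading_term_x1:
  "leading_term x1_sharp (Poly_Mapping.single Y1 1 + Poly_Mapping.single P1 1) (- 1)"
  by (rule leading_termI[where t = "- var P3 * var X1 + (var P2 * var S3 - var P4 * var T3) * var X1 + (var P2 * var S4 - var P4 * var T4) * var X2"],
      simp, simp, simp add: x1_sharp_def expand_monomial algebra_simps,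
      ((rule monomial_weight_var monomial.weight_le_intros)+)[1],
      simp add: straightening_weight_def monomial.W_add monomial_weight_single)

lemma leading_term_x2:
  "leading_term x2_sharp (Poly_Mapping.single Y2 1 + Poly_Mapping.single P1 1) (- 1)"
  by (rule leading_termI[where t = "- var P3 * var X2 - (var P2 * var S2 - var P4 * var T2) * var X1 - (var P2 * var S3 - var P4 * var T3) * var X2"],
      simp, simp, simp add: x2_sharp_def expand_monomial algebra_simps,
      ((rule monomial_weight_var monomial.weight_le_intros)+)[1],
      simp add: straightening_weight_def monomial.W_add monomial_weight_single)

lemma leading_term_y1:
  "leading_term y1_sharp (Poly_Mapping.single Y1 1 + Poly_Mapping.single P3 1) (- 1)"
  by (rule leading_termI[where t = "(- var Z * var P1 + var P2 * var S1 - var P4 * var T1) * var X1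
    - (var P2 * var S3 - var P4 * var T3) * var Y1 - (var P2 * var S4 - var P4 * var T4) * var Y2"],
      simp, simp, simp add: y1_sharp_def expand_monomial algebra_simps,
      ((rule monomial_weight_var monomial.weight_le_intros)+)[1],
      simp add: straightening_weight_def monomial.W_add monomial_weight_single)

lemma leading_term_y2:
  "leading_term y2_sharp (Poly_Mapping.single Y2 1 + Poly_Mapping.single P3 1) (- 1)"
  by (rule leading_termI[where t = "(- var Z * var P1 + var P2 * var S1 - var P4 * var T1) * var X2
    + (var P2 * var S2 - var P4 * var T2) * var Y1 + (var P2 * var S3 - var P4 * var T3) * var Y2"],
      simp, simp, simp add: y2_sharp_def expand_monomial algebra_simps,
      ((rule monomial_weight_var monomial.weight_le_intros)+)[1],
      simp add: straightening_weight_def monomial.W_add monomial_weight_single)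

lemma leading_term_u:
  "leading_term u_sharp (Poly_Mapping.single P3 2) 1"
  by (rule leading_termI[where t = "- var Z * (var P1)^2 + var P1 * (var P2 * var S1 - var P4 * var T1) - (var P2 * var S3 - var P4 * var T3)^2
    + (var P2 * var S2 - var P4 * var T2) * (var P2 * var S4 - var P4 * var T4)"],
      simp, simp, simp add: u_sharp_def expand_monomial algebra_simps,
      ((rule monomial_weight_var monomial.weight_le_intros)+)[1],
      simp add: straightening_weight_def monomial.W_add monomial_weight_single)

lemma not_standard_reducible:
  assumes "\<not> standard m"
  shows "\<exists>g e a. leading_term g e a \<and> (\<forall>c. Poly_Mapping.lookup e c \<le> Poly_Mapping.lookup m c)"
proof -
  let ?e = "Poly_Mapping.lookup m"
  have divides: ?thesis if "leading_term g e a" "\<forall>c\<in>UNIV. Poly_Mapping.lookup e c \<le> ?e c" for g e a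
    using that by blast
  consider "?e X1 \<ge> 2" "?e S2 \<ge> 1" "?e T1 \<ge> 1"
    | "?e X1 \<ge> 1" "?e Y2 \<ge> 1" "?e T1 \<ge> 1"
    | "?e X1 \<ge> 1" "?e Y1 \<ge> 1" "?e S2 \<ge> 1" "?e T1 \<ge> 1"
    | "?e Y1 \<ge> 2" "?e S2 \<ge> 1"
    | "?e Y1 \<ge> 1" "?e P1 \<ge> 1"
    | "?e Y2 \<ge> 1" "?e P1 \<ge> 1"
    | "?e Y1 \<ge> 1" "?e P3 \<ge> 1"
    | "?e Y2 \<ge> 1" "?e P3 \<ge> 1"
    | "?e P3 \<ge> 2"
    using assms unfolding standard_def Let_def by blast
  then show ?thesis
  proof cases
    case 1
    then show ?thesis
      by (intro divides[OF leading_term_p1]) (simp add: UNIV_coord lookup_add lookup_single)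
  next
    case 2
    then show ?thesis
      by (intro divides[OF leading_term_p2]) (simp add: UNIV_coord lookup_add lookup_single)
  next
    case 3
    then show ?thesis
      by (intro divides[OF leading_term_p3]) (simp add: UNIV_coord lookup_add lookup_single)
  next
    case 4
    then show ?thesis
      by (intro divides[OF leading_term_p4]) (simp add: UNIV_coord lookup_add lookup_single)
  next
    case 5
    then show ?thesis
      by (intro divides[OF leading_term_x1]) (simp add: UNIV_coord lookup_add lookup_single)
  next
    case 6
    then show ?thesis
      by (intro divides[OF leading_term_x2]) (simp add: UNIV_coord lookup_add lookup_single)
  next
    case 7
    then show ?thesis
      by (intro divides[OF leading_term_y1]) (simp add: UNIV_coord lookup_add lookup_single)
  next
    case 8
    then show ?thesis
      by (intro divides[OF leading_term_y2]) (simp add: UNIV_coord lookup_add lookup_single)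
  next
    case 9
    then show ?thesis
      by (intro divides[OF leading_term_u]) (simp add: UNIV_coord lookup_add lookup_single)
  qed
qed

theorem straightens_all: "straightens f"
proof (rule straightens_terms)
  have "straightens (Poly_Mapping.single m a)" for m a
  proof (induction "nat (monomial_weight m)" arbitrary: m a rule: less_induct)
    case less
    show ?case
    proof (cases "standard m")
      case True
      then have "standard_sum (Poly_Mapping.single m a)" by (simp add: standard_sum_def)
      then show ?thesis unfolding straightens_def using ideal_zero by (metis diff_self)
    next
      case False
      then obtain g e b where g: "leading_term g e b"
        and e: "\<And>c. Poly_Mapping.lookup e c \<le> Poly_Mapping.lookup m c"
        using not_standard_reducible by blast
      have "straightens (Poly_Mapping.single k d)" if "monomial_weight k < monomial_weight m" for k d
        using less that monomial_weight_nonneg[of k] by simp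
      then show ?thesis by (rule straightens_reduce[OF g e])
    qed
  qed
  then show "straightens (Poly_Mapping.single m (Poly_Mapping.lookup f m))" for m .
qed
section \<open>Leading exponents of the images of standard monomials\<close>

text \<open>These weights single out one monomial of \<open>u * p\<^sub>i\<close> for each \<open>i\<close>. They are chosen so that the
  resulting leading exponents separate the standard monomials.\<close>

definition image_weight :: "coord \<Rightarrow> int" where
  "image_weight c = (case c of Y2 \<Rightarrow> 1 | Z \<Rightarrow> - 1 | S2 \<Rightarrow> 3 | T1 \<Rightarrow> 3 | T4 \<Rightarrow> 1 | _ \<Rightarrow> 0)"

definition exponent_weight :: "(coord \<Rightarrow> int) \<Rightarrow> (coord \<Rightarrow>\<^sub>0 int) \<Rightarrow> int" where
  "exponent_weight w e = (\<Sum>c\<in>UNIV. w c * Poly_Mapping.lookup e c)"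

interpretation exponent: weight "exponent_weight w"
  by standard (simp add: exponent_weight_def lookup_add distrib_left sum.distrib)

lemma exponent_weight_single:
  "exponent_weight w (Poly_Mapping.single c n) = w c * n"
proof -
  have "exponent_weight w (Poly_Mapping.single c n) = (\<Sum>d\<in>UNIV. if d = c then w c * n else 0)"
    unfolding exponent_weight_def by (intro sum.cong) (auto simp: lookup_single when_def)
  then show ?thesis by simp
qed

lemma exponent_weight_lvar: "weight_le (exponent_weight w) (w c) (lvar c)"
  using exponent.weight_le_single[of w "Poly_Mapping.single c 1" 1]
  unfolding lvar_def exponent_weight_single by simp

lemma single_lvar: "Poly_Mapping.single (Poly_Mapping.single c 1) 1 = lvar c"
  by (simp add: lvar_def)

lemma single_lvar_square: "Poly_Mapping.single (Poly_Mapping.single c 2) 1 = lvar c ^ 2"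
  by (simp add: lvar_def power2_eq_square mult_single single_add[symmetric])

lemmas expand_exponent = single_one_mult single_lvar single_lvar_square single_uminus

definition coord_exponent :: "coord \<Rightarrow> coord \<Rightarrow>\<^sub>0 int" where
  "coord_exponent c = (case c of
     P1 \<Rightarrow> Poly_Mapping.single U (- 1) + (Poly_Mapping.single X1 2 + Poly_Mapping.single S2 1 + Poly_Mapping.single T1 1)
   | P2 \<Rightarrow> Poly_Mapping.single U (- 1) + (Poly_Mapping.single X1 1 + Poly_Mapping.single Y2 1 + Poly_Mapping.single T1 1)
   | P3 \<Rightarrow> Poly_Mapping.single U (- 1) + (Poly_Mapping.single X1 1 + Poly_Mapping.single Y1 1
       + Poly_Mapping.single S2 1 + Poly_Mapping.single T1 1)
   | P4 \<Rightarrow> Poly_Mapping.single U (- 1) + (Poly_Mapping.single Y1 2 + Poly_Mapping.single S2 1)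
   | _ \<Rightarrow> Poly_Mapping.single c 1)"

lemma lead_u_times_p1:
  "has_lead (exponent_weight image_weight) (Poly_Mapping.single X1 2 + Poly_Mapping.single S2 1 + Poly_Mapping.single T1 1)
    (u_times_p1 lvar)"
  by (rule exponent.has_leadI[where c = "1" and t = "- ((lvar X1)^2 * (lvar S1 * lvar T2) + 2 * lvar X1 * lvar X2 * (lvar S1 * lvar T3 - lvar S3 * lvar T1)
    + (lvar X2)^2 * (lvar S1 * lvar T4 - lvar S4 * lvar T1) + 2 * lvar X1 * lvar Y1 * (lvar S2 * lvar T3 - lvar S3 * lvar T2)
    + (lvar X1 * lvar Y2 + lvar X2 * lvar Y1) * (lvar S2 * lvar T4 - lvar S4 * lvar T2) + 2 * lvar X2 * lvar Y2 * (lvar S3 * lvar T4 - lvar S4 * lvar T3))"],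
      simp, simp add: u_times_p1_def expand_exponent algebra_simps del: single_of_int,
      ((rule exponent_weight_lvar exponent.weight_le_intros)+)[1],
      simp add: image_weight_def exponent.W_add exponent_weight_single)

lemma lead_u_times_p2:
  "has_lead (exponent_weight image_weight) (Poly_Mapping.single X1 1 + Poly_Mapping.single Y2 1 + Poly_Mapping.single T1 1)
    (u_times_p2 lvar)"
  by (rule exponent.has_leadI[where c = "- 1" and t = "lvar T1 * (lvar X2 * lvar Y1) + lvar T2 * ((lvar Y1)^2 - lvar Z * (lvar X1)^2)
    + 2 * lvar T3 * (lvar Y1 * lvar Y2 - lvar Z * lvar X1 * lvar X2) + lvar T4 * ((lvar Y2)^2 - lvar Z * (lvar X2)^2)"],
      simp, simp add: u_times_p2_def expand_exponent algebra_simps del: single_of_int,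
      ((rule exponent_weight_lvar exponent.weight_le_intros)+)[1],
      simp add: image_weight_def exponent.W_add exponent_weight_single)

lemma lead_u_times_p3:
  "has_lead (exponent_weight image_weight) (Poly_Mapping.single X1 1 + Poly_Mapping.single Y1 1 + Poly_Mapping.single S2 1 + Poly_Mapping.single T1 1)
    (u_times_p3 lvar)"
  by (rule exponent.has_leadI[where c = "- 1" and t = "lvar X1 * lvar Y1 * (lvar S1 * lvar T2)
    + (lvar X1 * lvar Y2 + lvar X2 * lvar Y1) * (lvar S1 * lvar T3 - lvar S3 * lvar T1) + lvar X2 * lvar Y2 * (lvar S1 * lvar T4 - lvar S4 * lvar T1)
    + ((lvar Y1)^2 + lvar Z * (lvar X1)^2) * (lvar S2 * lvar T3 - lvar S3 * lvar T2)
    + (lvar Y1 * lvar Y2 + lvar Z * lvar X1 * lvar X2) * (lvar S2 * lvar T4 - lvar S4 * lvar T2)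
    + ((lvar Y2)^2 + lvar Z * (lvar X2)^2) * (lvar S3 * lvar T4 - lvar S4 * lvar T3)"],
      simp, simp add: u_times_p3_def expand_exponent algebra_simps del: single_of_int,
      ((rule exponent_weight_lvar exponent.weight_le_intros)+)[1],
      simp add: image_weight_def exponent.W_add exponent_weight_single)

lemma lead_u_times_p4:
  "has_lead (exponent_weight image_weight) (Poly_Mapping.single Y1 2 + Poly_Mapping.single S2 1)
    (u_times_p4 lvar)"
  by (rule exponent.has_leadI[where c = "1" and t = "lvar S1 * (lvar X2 * lvar Y1 - lvar X1 * lvar Y2) - lvar S2 * (lvar Z * (lvar X1)^2)
    + 2 * lvar S3 * (lvar Y1 * lvar Y2 - lvar Z * lvar X1 * lvar X2) + lvar S4 * ((lvar Y2)^2 - lvar Z * (lvar X2)^2)"],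
      simp, simp add: u_times_p4_def expand_exponent algebra_simps del: single_of_int,
      ((rule exponent_weight_lvar exponent.weight_le_intros)+)[1],
      simp add: image_weight_def exponent.W_add exponent_weight_single)

lemma has_lead_image: "has_lead (exponent_weight image_weight) (coord_exponent c) (image c)"
proof -
  have var: "has_lead (exponent_weight image_weight) (Poly_Mapping.single c 1) (lvar c)" for c
    unfolding lvar_def by (rule exponent.has_lead_single) simp
  have inv: "has_lead (exponent_weight image_weight) (Poly_Mapping.single U (- 1)) u_inv"
    unfolding u_inv_def by (rule exponent.has_lead_single) simp
  show ?thesis
    using var[of c] exponent.has_lead_mult[OF inv lead_u_times_p1]
      exponent.has_lead_mult[OF inv lead_u_times_p2] exponent.has_lead_mult[OF inv lead_u_times_p3]
      exponent.has_lead_mult[OF inv lead_u_times_p4]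
    unfolding coord_exponent_def image_def by (cases c) simp_all
qed

definition lead_exponent :: "(coord \<Rightarrow>\<^sub>0 nat) \<Rightarrow> coord \<Rightarrow>\<^sub>0 int" where
  "lead_exponent m = (\<Sum>c\<in>UNIV. frag_cmul (int (Poly_Mapping.lookup m c)) (coord_exponent c))"

lemma has_lead_power:
  fixes f :: laurent
  assumes "has_lead (exponent_weight w) e f"
  shows "has_lead (exponent_weight w) (frag_cmul (int n) e) (f ^ n)"
proof (induction n)
  case 0
  show ?case using exponent.has_lead_one by simp
next
  case (Suc n)
  have "frag_cmul (int (Suc n)) e = e + frag_cmul (int n) e"
    by (rule poly_mapping_eqI) (simp add: lookup_add algebra_simps)
  then show ?case using exponent.has_lead_mult[OF assms Suc.IH] by simp
qed

lemma has_lead_monomial: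
  "has_lead (exponent_weight image_weight) (lead_exponent m) (Phi (Poly_Mapping.single m 1))"
proof -
  have "has_lead (exponent_weight image_weight)
      (\<Sum>c\<in>S. frag_cmul (int (Poly_Mapping.lookup m c)) (coord_exponent c))
      (\<Prod>c\<in>S. image c ^ Poly_Mapping.lookup m c)" if "finite S" for S
    using that
  proof induction
    case empty
    show ?case using exponent.has_lead_one by simp
  next
    case (insert c S)
    then show ?case
      using exponent.has_lead_mult[OF has_lead_power[OF has_lead_image[of c]] insert.IH] by simp
  qed
  then show ?thesis by (simp add: Phi_def const.evaluate_single lead_exponent_def)
qed

lemma lookup_lead_exponent:
  fixes m :: "coord \<Rightarrow>\<^sub>0 nat"
  defines "e \<equiv> \<lambda>c. int (Poly_Mapping.lookup m c)"
  shows "Poly_Mapping.lookup (lead_exponent m) U = e U - e P1 - e P2 - e P3 - e P4"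
    and "Poly_Mapping.lookup (lead_exponent m) X1 = e X1 + 2 * e P1 + e P2 + e P3"
    and "Poly_Mapping.lookup (lead_exponent m) Y1 = e Y1 + e P3 + 2 * e P4"
    and "Poly_Mapping.lookup (lead_exponent m) Y2 = e Y2 + e P2"
    and "Poly_Mapping.lookup (lead_exponent m) S2 = e S2 + e P1 + e P3 + e P4"
    and "Poly_Mapping.lookup (lead_exponent m) T1 = e T1 + e P1 + e P2 + e P3"
    and "c \<in> {X2, Z, S1, S3, S4, T2, T3, T4} \<Longrightarrow> Poly_Mapping.lookup (lead_exponent m) c = e c"
  unfolding lead_exponent_def e_def
  by (auto simp: lookup_sum UNIV_coord coord_exponent_def lookup_add lookup_single)

lemma standardD:
  fixes m :: "coord \<Rightarrow>\<^sub>0 nat"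
  defines "e \<equiv> Poly_Mapping.lookup m"
  assumes "standard m"
  shows "e X1 \<le> 1 \<or> e S2 = 0 \<or> e T1 = 0"
    and "e X1 = 0 \<or> e Y2 = 0 \<or> e T1 = 0"
    and "e X1 = 0 \<or> e Y1 = 0 \<or> e S2 = 0 \<or> e T1 = 0"
    and "e Y1 \<le> 1 \<or> e S2 = 0"
    and "e Y1 = 0 \<or> e P1 = 0"
    and "e Y2 = 0 \<or> e P1 = 0"
    and "e Y1 = 0 \<or> e P3 = 0"
    and "e Y2 = 0 \<or> e P3 = 0"
    and "e P3 \<le> 1"
proof -
  note std = assms(2)[unfolded standard_def Let_def, folded e_def]
  have "\<not> (2 \<le> e X1 \<and> 1 \<le> e S2 \<and> 1 \<le> e T1)" using std by blast
  then show "e X1 \<le> 1 \<or> e S2 = 0 \<or> e T1 = 0" by linarith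
  have "\<not> (1 \<le> e X1 \<and> 1 \<le> e Y2 \<and> 1 \<le> e T1)" using std by blast
  then show "e X1 = 0 \<or> e Y2 = 0 \<or> e T1 = 0" by linarith
  have "\<not> (1 \<le> e X1 \<and> 1 \<le> e Y1 \<and> 1 \<le> e S2 \<and> 1 \<le> e T1)" using std by blast
  then show "e X1 = 0 \<or> e Y1 = 0 \<or> e S2 = 0 \<or> e T1 = 0" by linarith
  have "\<not> (2 \<le> e Y1 \<and> 1 \<le> e S2)" using std by blast
  then show "e Y1 \<le> 1 \<or> e S2 = 0" by linarith
  have "\<not> (1 \<le> e Y1 \<and> 1 \<le> e P1)" using std by blast
  then show "e Y1 = 0 \<or> e P1 = 0" by linarith
  have "\<not> (1 \<le> e Y2 \<and> 1 \<le> e P1)" using std by blast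
  then show "e Y2 = 0 \<or> e P1 = 0" by linarith
  have "\<not> (1 \<le> e Y1 \<and> 1 \<le> e P3)" using std by blast
  then show "e Y1 = 0 \<or> e P3 = 0" by linarith
  have "\<not> (1 \<le> e Y2 \<and> 1 \<le> e P3)" using std by blast
  then show "e Y2 = 0 \<or> e P3 = 0" by linarith
  have "\<not> (2 \<le> e P3)" using std by blast
  then show "e P3 \<le> 1" by linarith
qed

text \<open>The exponents of \<open>p1\<close>, ..., \<open>p4\<close> in a standard monomial can be recovered one after the
  other: were one of them smaller than in another monomial with the same leading exponent, the
  missing factors would have to come from the remaining variables, which would then be divisible
  by a leading monomial.\<close>

lemma lead_exponent_inj: "inj_on lead_exponent (Collect standard)"
proof
  have le: "Poly_Mapping.lookup n P2 \<le> Poly_Mapping.lookup m P2 \<and>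
      (Poly_Mapping.lookup n P2 = Poly_Mapping.lookup m P2 \<longrightarrow>
        Poly_Mapping.lookup n P4 \<le> Poly_Mapping.lookup m P4) \<and>
      (Poly_Mapping.lookup n P2 = Poly_Mapping.lookup m P2 \<longrightarrow>
        Poly_Mapping.lookup n P4 = Poly_Mapping.lookup m P4 \<longrightarrow>
        Poly_Mapping.lookup n P3 \<le> Poly_Mapping.lookup m P3) \<and>
      (Poly_Mapping.lookup n P2 = Poly_Mapping.lookup m P2 \<longrightarrow>
        Poly_Mapping.lookup n P4 = Poly_Mapping.lookup m P4 \<longrightarrow>
        Poly_Mapping.lookup n P3 = Poly_Mapping.lookup m P3 \<longrightarrow>
        Poly_Mapping.lookup n P1 \<le> Poly_Mapping.lookup m P1)"
    if "standard m" "standard n" "lead_exponent m = lead_exponent n" for m n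
  proof -
    let ?a = "Poly_Mapping.lookup m" and ?b = "Poly_Mapping.lookup n"
    note m_exps = lookup_lead_exponent(1-6)[of m] and n_exps = lookup_lead_exponent(1-6)[of n]
    have X1: "?b X1 + 2 * ?b P1 + ?b P2 + ?b P3 = ?a X1 + 2 * ?a P1 + ?a P2 + ?a P3" 
      using m_exps(2) n_exps(2) that(3) by simp
    have Y1: "?b Y1 + ?b P3 + 2 * ?b P4 = ?a Y1 + ?a P3 + 2 * ?a P4" 
      using m_exps(3) n_exps(3) that(3) by simp
    have Y2: "?b Y2 + ?b P2 = ?a Y2 + ?a P2" 
      using m_exps(4) n_exps(4) that(3) by simp
    have S2: "?b S2 + ?b P1 + ?b P3 + ?b P4 = ?a S2 + ?a P1 + ?a P3 + ?a P4" 
      using m_exps(5) n_exps(5) that(3) by simp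
    have T1: "?b T1 + ?b P1 + ?b P2 + ?b P3 = ?a T1 + ?a P1 + ?a P2 + ?a P3" 
      using m_exps(6) n_exps(6) that(3) by simp
    note std = standardD[OF that(1)]
    show ?thesis
    proof (intro conjI impI)
      show "?b P2 \<le> ?a P2"
      proof (rule ccontr)
        assume lt: "\<not> ?b P2 \<le> ?a P2"
        then have "1 \<le> ?a Y2" using Y2 by linarith
        then have "?a P1 = 0" "?a P3 = 0" using std(6,8) by auto
        then have "1 \<le> ?a X1" "1 \<le> ?a T1" using X1 T1 lt by linarith+
        then show False using std(2) \<open>1 \<le> ?a Y2\<close> by auto
      qed
    next
      assume p2: "?b P2 = ?a P2"
      show "?b P4 \<le> ?a P4"
      proof (rule ccontr)
        assume lt: "\<not> ?b P4 \<le> ?a P4"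
        then have "2 \<le> ?a Y1 + ?a P3" using Y1 by linarith
        then have "1 \<le> ?a Y1" using std(9) by linarith
        then have "?a P3 = 0" "?a P1 = 0" using std(5,7) by auto
        then have "?a S2 = 0" using std(4) \<open>2 \<le> ?a Y1 + ?a P3\<close> by auto
        then show False using S2 \<open>?a P3 = 0\<close> \<open>?a P1 = 0\<close> lt by linarith
      qed
    next
      assume p2: "?b P2 = ?a P2" and p4: "?b P4 = ?a P4"
      show "?b P3 \<le> ?a P3"
      proof (rule ccontr)
        assume "\<not> ?b P3 \<le> ?a P3"
        then have p3: "?a P3 = 0" "?b P3 = 1" using standardD(9)[OF that(2)] by linarith+
        then have "1 \<le> ?a Y1" using Y1 p4 by linarith
        then have "?a P1 = 0" using std(5) by auto
        then have "1 \<le> ?a X1" "1 \<le> ?a S2" "1 \<le> ?a T1" using X1 S2 T1 p2 p3 p4 by linarith+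
        then show False using std(3) \<open>1 \<le> ?a Y1\<close> by auto
      qed
    next
      assume p: "?b P2 = ?a P2" "?b P4 = ?a P4" "?b P3 = ?a P3"
      show "?b P1 \<le> ?a P1"
      proof (rule ccontr)
        assume "\<not> ?b P1 \<le> ?a P1"
        then have "2 \<le> ?a X1" "1 \<le> ?a S2" "1 \<le> ?a T1" using X1 S2 T1 p by linarith+
        then show False using std(1) by auto
      qed
    qed
  qed
  fix m n assume mn: "m \<in> Collect standard" "n \<in> Collect standard" "lead_exponent m = lead_exponent n"
  then have le_mn: "standard m" "standard n" "lead_exponent n = lead_exponent m" by simp_all
  note le1 = le[OF le_mn(1,2) mn(3)] and le2 = le[OF le_mn(2,1,3)]
  have p2: "Poly_Mapping.lookup n P2 = Poly_Mapping.lookup m P2"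
    using conjunct1[OF le1] conjunct1[OF le2] by (rule antisym)
  then have p4: "Poly_Mapping.lookup n P4 = Poly_Mapping.lookup m P4"
    using le1 le2 by linarith
  then have p3: "Poly_Mapping.lookup n P3 = Poly_Mapping.lookup m P3"
    using le1 le2 p2 by linarith
  then have p1: "Poly_Mapping.lookup n P1 = Poly_Mapping.lookup m P1"
    using le1 le2 p2 p4 by linarith
  show "m = n"
  proof (rule poly_mapping_eqI)
    fix c
    show "Poly_Mapping.lookup m c = Poly_Mapping.lookup n c"
      using lookup_lead_exponent(1-6)[of m] lookup_lead_exponent(7)[of c m]
        lookup_lead_exponent(1-6)[of n] lookup_lead_exponent(7)[of c n] mn(3) p1 p2 p3 p4
      by (cases c) simp_all
  qed
qed

lemma Phi_terms:
  "Phi f = (\<Sum>m\<in>Poly_Mapping.keys f. Poly_Mapping.single 0 (Poly_Mapping.lookup f m) * Phi (Poly_Mapping.single m 1))"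
  by (simp add: Phi_def evaluate_def[of _ _ f] const.evaluate_single)

text \<open>Every polynomial is congruent to a sum of standard monomials, and the images of these are
  linearly independent, having different leading exponents.\<close>

theorem kernel_Phi: "{f. Phi f = 0} = upsilon_ideal"
proof
  show "upsilon_ideal \<subseteq> {f. Phi f = 0}" using Phi_kills_ideal by blast
  show "{f. Phi f = 0} \<subseteq> upsilon_ideal"
  proof
    fix f assume "f \<in> {f. Phi f = 0}"
    moreover obtain s where s: "standard_sum s" "f - s \<in> upsilon_ideal"
      using straightens_all unfolding straightens_def by blast
    ultimately have "Phi s = 0" using Phi_kills_ideal[OF s(2)] by (simp add: Phi.simps)
    have "\<forall>m\<in>Poly_Mapping.keys s. Poly_Mapping.lookup s m = 0"
    proof (rule lead_independent)
      show "inj_on lead_exponent (Poly_Mapping.keys s)"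
        using s(1) by (intro inj_on_subset[OF lead_exponent_inj]) (auto simp: standard_sum_def)
      show "(\<Sum>m\<in>Poly_Mapping.keys s. Poly_Mapping.single 0 (Poly_Mapping.lookup s m)
        * Phi (Poly_Mapping.single m 1)) = 0" unfolding Phi_terms[symmetric] by fact
    qed (rule finite_keys has_lead_monomial)+
    then have "Poly_Mapping.lookup s m = 0" for m by (cases "m \<in> Poly_Mapping.keys s") (auto simp: in_keys_iff)
    then have "s = 0" by (intro poly_mapping_eqI) simp
    then show "f \<in> upsilon_ideal" using s by simp
  qed
qed
section \<open>The hypersurface u = 0\<close>

text \<open>On the open set where \<open>q\<^sub>t\<close> is invertible the equations with \<open>u = 0\<close> can be solved for
  \<open>z\<close>, \<open>s1\<close>, \<open>p3\<close> and \<open>p4\<close>. The four numerators below are the values of the products of \<open>q\<^sub>t\<close>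
  with these coordinates.\<close>

definition q_t :: "(coord \<Rightarrow> 'r::comm_ring_1) \<Rightarrow> 'r" where
  "q_t v = (v X1)^2 * v T2 + 2 * v X1 * v X2 * v T3 + (v X2)^2 * v T4"

definition q_s :: "(coord \<Rightarrow> 'r::comm_ring_1) \<Rightarrow> 'r" where
  "q_s v = (v X1)^2 * v S2 + 2 * v X1 * v X2 * v S3 + (v X2)^2 * v S4"

definition z_numerator :: "(coord \<Rightarrow> 'r::comm_ring_1) \<Rightarrow> 'r" where
  "z_numerator v = (v Y1)^2 * v T2 + 2 * v Y1 * v Y2 * v T3 + (v Y2)^2 * v T4
     - v T1 * (v X1 * v Y2 - v X2 * v Y1)"

definition s1_numerator :: "(coord \<Rightarrow> 'r::comm_ring_1) \<Rightarrow> 'r" where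
  "s1_numerator v = v T1 * q_s v - (2 * v X1 * v Y1 * (v S2 * v T3 - v S3 * v T2)
     + (v X1 * v Y2 + v X2 * v Y1) * (v S2 * v T4 - v S4 * v T2)
     + 2 * v X2 * v Y2 * (v S3 * v T4 - v S4 * v T3))"

definition p3_numerator :: "(coord \<Rightarrow> 'r::comm_ring_1) \<Rightarrow> 'r" where
  "p3_numerator v = v P2 * ((v S3 * v X1 + v S4 * v X2) * (v X1 * v T2 + v X2 * v T3)
       - (v S2 * v X1 + v S3 * v X2) * (v X1 * v T3 + v X2 * v T4))
     - v P1 * (v Y1 * (v X1 * v T2 + v X2 * v T3) + v Y2 * (v X1 * v T3 + v X2 * v T4))"

definition p4_numerator :: "(coord \<Rightarrow> 'r::comm_ring_1) \<Rightarrow> 'r" where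
  "p4_numerator v = v P2 * q_s v + v P1 * (v X1 * v Y2 - v X2 * v Y1)"

lemma q_t_times_z: "q_t var * var Z = z_numerator var - var U * var P2 - p2_sharp"
  by (simp add: q_t_def z_numerator_def p2_sharp_def algebra_simps)

lemma q_t_times_s1: "q_t var * var S1 = s1_numerator var - var U * var P1 - p1_sharp"
  by (simp add: q_t_def q_s_def s1_numerator_def p1_sharp_def algebra_simps)

lemma q_t_times_p3: "q_t var * var P3 = p3_numerator var
    - ((var X1 * var T2 + var X2 * var T3) * x1_sharp + (var X1 * var T3 + var X2 * var T4) * x2_sharp)"
  by (simp add: q_t_def p3_numerator_def x1_sharp_def x2_sharp_def algebra_simps power2_eq_square)

lemma q_t_times_p4: "q_t var * var P4 = p4_numerator var + (var X1 * x2_sharp - var X2 * x1_sharp)"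
  by (simp add: q_t_def q_s_def p4_numerator_def x1_sharp_def x2_sharp_def algebra_simps power2_eq_square)

subsection \<open>Regularity of q_t modulo u\<close>

lemma Phi_var_outside: "c \<notin> {P1, P2, P3, P4} \<Longrightarrow> Phi (var c) = lvar c"
  unfolding Phi_var image_def by (cases c) simp_all

lemma Phi_q_t: "Phi (q_t var) = q_t lvar"
  by (simp add: q_t_def Phi.simps Phi_var_outside)

lemma has_lead_q_t:
  "has_lead (exponent_weight image_weight) (Poly_Mapping.single X2 2 + Poly_Mapping.single T4 1) (q_t lvar)"
  by (rule exponent.has_leadI[where c = "1" and t = "(lvar X1)^2 * lvar T2 + 2 * lvar X1 * lvar X2 * lvar T3"],
      simp, simp add: q_t_def expand_exponent del: single_of_int,
      ((rule exponent_weight_lvar exponent.weight_le_intros)+)[1],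
      simp add: image_weight_def exponent.W_add exponent_weight_single)

definition u_multiple :: "upsilon_poly \<Rightarrow> bool" where
  "u_multiple f \<longleftrightarrow> (\<exists>h. Phi f = lvar U * Phi h)"

lemma u_multiple_add: "u_multiple f \<Longrightarrow> u_multiple g \<Longrightarrow> u_multiple (f + g)"
  unfolding u_multiple_def by (metis Phi.add distrib_left)

lemma u_multiple_mult: "u_multiple f \<Longrightarrow> u_multiple (g * f)"
  unfolding u_multiple_def by (metis Phi.mult mult.left_commute)

lemma u_multiple_U: "u_multiple (var U)"
  unfolding u_multiple_def by (intro exI[of _ 1]) (simp add: Phi_var_outside Phi.one)

lemma u_multiple_ideal: "f \<in> upsilon_ideal \<Longrightarrow> u_multiple f"
  unfolding u_multiple_def using Phi_kills_ideal by (intro exI[of _ 0]) (simp add: Phi.zero)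

text \<open>Multiplying the standard monomials without \<open>u\<close> by \<open>x2\<^sup>2 t4\<close>, the leading monomial of \<open>q\<^sub>t\<close>,
  gives standard monomials without \<open>u\<close>. Their leading exponents differ from those of the standard
  multiples of \<open>u\<close>, so no combination of the former, multiplied by \<open>q\<^sub>t\<close>, is a multiple of \<open>u\<close>.\<close>

definition q_t_shift :: "(coord \<Rightarrow>\<^sub>0 nat) \<Rightarrow> coord \<Rightarrow>\<^sub>0 nat" where
  "q_t_shift m = (if Poly_Mapping.lookup m U = 0
     then Poly_Mapping.single X2 2 + Poly_Mapping.single T4 1 + m else m)"

lemma standard_cong:
  assumes "\<And>c. c \<notin> {U, X2, T4} \<Longrightarrow> Poly_Mapping.lookup m c = Poly_Mapping.lookup n c"
  shows "standard m \<longleftrightarrow> standard n"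
  unfolding standard_def Let_def by (simp add: assms)

lemma standard_shift: "standard m \<Longrightarrow> standard (q_t_shift m)"
proof -
  have "standard (q_t_shift m) \<longleftrightarrow> standard m"
    by (rule standard_cong) (auto simp: q_t_shift_def lookup_add lookup_single when_def)
  then show "standard m \<Longrightarrow> standard (q_t_shift m)" by blast
qed

lemma q_t_shift_inj: "inj q_t_shift"
proof
  fix m n assume eq: "q_t_shift m = q_t_shift n"
  have "Poly_Mapping.lookup (q_t_shift k) U = Poly_Mapping.lookup k U" for k
    by (simp add: q_t_shift_def lookup_add lookup_single)
  then have "Poly_Mapping.lookup m U = Poly_Mapping.lookup n U" using eq by metis
  then show "m = n" using eq unfolding q_t_shift_def by (auto split: if_splits)
qed

lemma lead_exponent_add: "lead_exponent (m + n) = lead_exponent m + lead_exponent n"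
  by (rule poly_mapping_eqI)
    (simp add: lead_exponent_def lookup_sum lookup_add sum.distrib algebra_simps)

lemma lead_exponent_q_t:
  "lead_exponent (Poly_Mapping.single X2 2 + Poly_Mapping.single T4 1)
    = Poly_Mapping.single X2 2 + Poly_Mapping.single T4 1"
proof (rule poly_mapping_eqI)
  fix c
  show "Poly_Mapping.lookup (lead_exponent (Poly_Mapping.single X2 2 + Poly_Mapping.single T4 1)) c
    = Poly_Mapping.lookup (Poly_Mapping.single X2 2 + Poly_Mapping.single T4 1) c"
    by (cases c) (simp_all add: lead_exponent_def lookup_sum UNIV_coord coord_exponent_def lookup_add
      lookup_single del: single_of_int)
qed

lemma has_lead_shift:
  "has_lead (exponent_weight image_weight) (lead_exponent (q_t_shift m))
    ((if Poly_Mapping.lookup m U = 0 then q_t lvar else 1) * Phi (Poly_Mapping.single m 1))"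
proof (cases "Poly_Mapping.lookup m U = 0")
  case True
  show ?thesis
    unfolding q_t_shift_def if_P[OF True] lead_exponent_add[of "Poly_Mapping.single X2 2 + Poly_Mapping.single T4 1"]
      lead_exponent_q_t
    by (rule exponent.has_lead_mult[OF has_lead_q_t has_lead_monomial])
next
  case False
  then show ?thesis using has_lead_monomial[of m] by (simp add: q_t_shift_def)
qed

lemma q_t_combination_zero:
  assumes std: "standard_sum s" "standard_sum t"
    and no_u: "\<And>m. m \<in> Poly_Mapping.keys s \<Longrightarrow> Poly_Mapping.lookup m U = 0"
    and eq: "q_t lvar * Phi s = lvar U * Phi t"
  shows "s = 0"
proof -
  let ?u = "Poly_Mapping.single U 1 :: coord \<Rightarrow>\<^sub>0 nat"
  \<comment> \<open>One relation between images indexed by monomials: those of \<open>s\<close> contribute with the factor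
    \<open>q\<^sub>t\<close>, and those of \<open>u * t\<close>, which are told apart by containing \<open>u\<close>, without it.\<close>
  define T where "T = (\<lambda>m. ?u + m) ` Poly_Mapping.keys t"
  define a where "a m = (if Poly_Mapping.lookup m U = 0 then Poly_Mapping.lookup s m
    else - Poly_Mapping.lookup t (m - ?u))" for m
  define F where "F m = (if Poly_Mapping.lookup m U = 0 then q_t lvar else 1) * Phi (Poly_Mapping.single m 1)" for m
  have T_u: "Poly_Mapping.lookup m U \<noteq> 0" if "m \<in> T" for m
    using that unfolding T_def by (auto simp: lookup_add)
  have T_std: "standard m" if mT: "m \<in> T" for m
  proof -
    obtain n where n: "m = ?u + n" "n \<in> Poly_Mapping.keys t"
      using mT unfolding T_def by blast
    have "standard (?u + n) \<longleftrightarrow> standard n"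
      by (rule standard_cong) (auto simp: lookup_add lookup_single when_def)
    then show ?thesis using n std(2) unfolding standard_sum_def by blast
  qed
  have "(\<Sum>m\<in>T. Poly_Mapping.single 0 (a m) * F m) = - (lvar U * Phi t)"
  proof -
    have "(\<Sum>m\<in>T. Poly_Mapping.single 0 (a m) * F m)
      = (\<Sum>m\<in>Poly_Mapping.keys t. Poly_Mapping.single 0 (a (?u + m)) * F (?u + m))"
      unfolding T_def by (rule sum.reindex_cong[of "\<lambda>m. ?u + m"]) (auto simp: inj_on_def)
    also have "\<dots> = (\<Sum>m\<in>Poly_Mapping.keys t. - (lvar U *
        (Poly_Mapping.single 0 (Poly_Mapping.lookup t m) * Phi (Poly_Mapping.single m 1))))"
    proof (rule sum.cong[OF refl])
      fix m
      have "Phi (Poly_Mapping.single (?u + m) 1) = lvar U * Phi (Poly_Mapping.single m 1)"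
        unfolding single_one_mult Phi.mult using Phi_var_outside[of U] by (simp add: var_def)
      moreover have "?u + m - ?u = m" by simp
      ultimately show "Poly_Mapping.single 0 (a (?u + m)) * F (?u + m)
        = - (lvar U * (Poly_Mapping.single 0 (Poly_Mapping.lookup t m) * Phi (Poly_Mapping.single m 1)))"
        by (simp add: a_def F_def lookup_add single_uminus ac_simps)
    qed
    also have "\<dots> = - (lvar U * Phi t)"
      by (simp add: sum_negf sum_distrib_left[symmetric] Phi_terms[symmetric])
    finally show ?thesis .
  qed
  moreover have "(\<Sum>m\<in>Poly_Mapping.keys s. Poly_Mapping.single 0 (a m) * F m) = q_t lvar * Phi s"
    unfolding Phi_terms[of s] sum_distrib_left
    by (rule sum.cong) (auto simp: a_def F_def no_u ac_simps)
  moreover have "Poly_Mapping.keys s \<inter> T = {}" using T_u no_u by blast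
  ultimately have sum: "(\<Sum>m\<in>Poly_Mapping.keys s \<union> T. Poly_Mapping.single 0 (a m) * F m) = 0"
    using eq by (subst sum.union_disjoint) (simp_all add: T_def)
  have inj: "inj_on (\<lambda>m. lead_exponent (q_t_shift m)) (Poly_Mapping.keys s \<union> T)"
  proof (rule inj_onI)
    fix m n assume mn: "m \<in> Poly_Mapping.keys s \<union> T" "n \<in> Poly_Mapping.keys s \<union> T"
      "lead_exponent (q_t_shift m) = lead_exponent (q_t_shift n)"
    then have "standard (q_t_shift m)" "standard (q_t_shift n)"
      using std(1) T_std standard_shift unfolding standard_sum_def by blast+
    then have "q_t_shift m = q_t_shift n" using inj_onD[OF lead_exponent_inj mn(3)] by simp
    then show "m = n" using q_t_shift_inj by (simp add: inj_def)
  qed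
  have lead: "has_lead (exponent_weight image_weight) (lead_exponent (q_t_shift m)) (F m)" for m
    unfolding F_def by (rule has_lead_shift)
  have "finite (Poly_Mapping.keys s \<union> T)" by (simp add: T_def)
  then have a0: "\<forall>m\<in>Poly_Mapping.keys s \<union> T. a m = 0"
    using lead inj sum by (rule lead_independent)
  have "Poly_Mapping.keys s = {}"
  proof (rule equals0I)
    fix m assume m: "m \<in> Poly_Mapping.keys s"
    then have "a m = 0" using a0 by blast
    then have "Poly_Mapping.lookup s m = 0" using no_u[OF m] unfolding a_def by simp
    then show False using m by (simp add: in_keys_iff)
  qed
  then show ?thesis by simp
qed

theorem u_multiple_cancel_q_t:
  assumes "u_multiple (q_t var * f)"
  shows "u_multiple f"
proof -
  let ?u = "Poly_Mapping.single U 1 :: coord \<Rightarrow>\<^sub>0 nat"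
  obtain h where h: "q_t lvar * Phi f = lvar U * Phi h"
    using assms unfolding u_multiple_def Phi.mult Phi_q_t by blast
  obtain s where s: "standard_sum s" "f - s \<in> upsilon_ideal"
    using straightens_all unfolding straightens_def by blast
  \<comment> \<open>The terms of \<open>s\<close> divisible by \<open>u\<close> are moved to the other side of the relation \<open>h\<close>.\<close>
  define K where "K = {m \<in> Poly_Mapping.keys s. Poly_Mapping.lookup m U = 0}"
  define s0 where "s0 = (\<Sum>m\<in>K. Poly_Mapping.single m (Poly_Mapping.lookup s m))"
  define r where "r = (\<Sum>m\<in>Poly_Mapping.keys s - K. Poly_Mapping.single (m - ?u) (Poly_Mapping.lookup s m))"
  have "var U * r = (\<Sum>m\<in>Poly_Mapping.keys s - K. Poly_Mapping.single m (Poly_Mapping.lookup s m))"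
    unfolding r_def sum_distrib_left
  proof (rule sum.cong[OF refl])
    fix m assume "m \<in> Poly_Mapping.keys s - K"
    then have "?u + (m - ?u) = m"
      by (intro poly_mapping_eqI) (auto simp: K_def lookup_add lookup_minus lookup_single when_def)
    then show "var U * Poly_Mapping.single (m - ?u) (Poly_Mapping.lookup s m)
      = Poly_Mapping.single m (Poly_Mapping.lookup s m)" by (simp add: var_def mult_single)
  qed
  then have "s0 + var U * r = (\<Sum>m\<in>Poly_Mapping.keys s. Poly_Mapping.single m (Poly_Mapping.lookup s m))"
    unfolding s0_def by (subst add.commute, simp, intro sum.subset_diff[symmetric]) (auto simp: K_def)
  then have split: "s = s0 + var U * r" using poly_mapping_sum_single[of s] by simp
  have lookup_s0: "Poly_Mapping.lookup s0 m = (if m \<in> K then Poly_Mapping.lookup s m else 0)" for m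
    by (simp add: s0_def lookup_sum lookup_single when_def K_def)
  have s0: "m \<in> K" if "m \<in> Poly_Mapping.keys s0" for m
    using that by (auto simp: in_keys_iff lookup_s0 split: if_splits)
  then have "standard_sum s0" "\<And>m. m \<in> Poly_Mapping.keys s0 \<Longrightarrow> Poly_Mapping.lookup m U = 0"
    using s(1) unfolding standard_sum_def K_def by blast+
  note s0_props = this
  obtain t where t: "standard_sum t" "h - q_t var * r - t \<in> upsilon_ideal"
    using straightens_all unfolding straightens_def by blast
  have "Phi f = Phi s" using Phi_kills_ideal[OF s(2)] by (simp add: Phi.diff)
  then have Phi_f: "Phi f = Phi s0 + lvar U * Phi r"
    unfolding split by (simp add: Phi.simps Phi_var_outside)
  have "Phi t = Phi h - q_t lvar * Phi r"
    using Phi_kills_ideal[OF t(2)] by (simp add: Phi.simps Phi_q_t)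
  then have "lvar U * Phi t = lvar U * Phi h - q_t lvar * (lvar U * Phi r)"
    by (simp only: right_diff_distrib mult.left_commute)
  also have "\<dots> = q_t lvar * Phi s0" unfolding h[symmetric] Phi_f by (simp add: algebra_simps)
  finally have "s0 = 0" using q_t_combination_zero[OF s0_props(1) t(1) s0_props(2)] by simp
  then show ?thesis unfolding u_multiple_def Phi_f using Phi.zero by auto
qed
subsection \<open>The chart where q_t is invertible\<close>

text \<open>At \<open>u = 0\<close> each of the first eight generators has degree at most one in the coordinates
  \<open>z, s1, p3, p4\<close> taken together, so multiplication by a single factor \<open>q\<^sub>t\<close> clears all
  denominators. The last generator is quadratic in them and left to \<open>kills_u_sharp\<close>.\<close>

lemma chart_kills:
  fixes v :: "coord \<Rightarrow> 'r::idom" and \<phi> :: "upsilon_poly \<Rightarrow> 'r"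
  assumes "ring_morphism \<phi>" and v: "\<And>c. \<phi> (var c) = v c"
    and u: "v U = 0" and nonzero: "v X1 \<noteq> 0" "q_t v \<noteq> 0"
    and z: "q_t v * v Z = z_numerator v" and s1: "q_t v * v S1 = s1_numerator v"
    and p3: "q_t v * v P3 = p3_numerator v" and p4: "q_t v * v P4 = p4_numerator v"
    and g: "g \<in> upsilon_generators"
  shows "\<phi> g = 0"
proof -
  interpret \<phi>: ring_morphism \<phi> by fact
  have q: "\<phi> (q_t var) = q_t v" by (simp add: q_t_def \<phi>.simps v)
  define w where "w = q_t v"
  note eqs = z[folded w_def] s1[folded w_def] p3[folded w_def] p4[folded w_def]
  note numerators = z_numerator_def s1_numerator_def p3_numerator_def p4_numerator_def q_s_def
  have "\<phi> p2_sharp = 0"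
    using arg_cong[OF q_t_times_z, of \<phi>] z u by (simp add: \<phi>.simps v q z_numerator_def)
  moreover have "\<phi> p1_sharp = 0"
    using arg_cong[OF q_t_times_s1, of \<phi>] s1 u by (simp add: \<phi>.simps v q s1_numerator_def q_s_def)
  moreover have "w * \<phi> p3_sharp = 0"
  proof -
    have "w * \<phi> p3_sharp = - (v X1 * v Y1 * ((w * v S1) * v T2 - w * (v S2 * v T1))
       + (v X1 * v Y2 + v X2 * v Y1) * ((w * v S1) * v T3 - w * (v S3 * v T1))
       + v X2 * v Y2 * ((w * v S1) * v T4 - w * (v S4 * v T1))
       + (w * (v Y1)^2 + (w * v Z) * (v X1)^2) * (v S2 * v T3 - v S3 * v T2)
       + (w * (v Y1 * v Y2) + (w * v Z) * (v X1 * v X2)) * (v S2 * v T4 - v S4 * v T2)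
       + (w * (v Y2)^2 + (w * v Z) * (v X2)^2) * (v S3 * v T4 - v S4 * v T3))"
      by (simp add: p3_sharp_def \<phi>.simps v u algebra_simps)
    also have "\<dots> = 0"
      unfolding eqs numerators by (simp add: w_def q_t_def algebra_simps power2_eq_square)
    finally show ?thesis .
  qed
  moreover have "w * \<phi> p4_sharp = 0"
  proof -
    have "w * \<phi> p4_sharp = (w * v S1) * (v X2 * v Y1 - v X1 * v Y2)
      + v S2 * (w * (v Y1)^2 - (w * v Z) * (v X1)^2)
      + 2 * v S3 * (w * (v Y1 * v Y2) - (w * v Z) * (v X1 * v X2))
      + v S4 * (w * (v Y2)^2 - (w * v Z) * (v X2)^2)"
      by (simp add: p4_sharp_def \<phi>.simps v u algebra_simps)
    also have "\<dots> = 0"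
      unfolding eqs numerators by (simp add: w_def q_t_def algebra_simps power2_eq_square)
    finally show ?thesis .
  qed
  moreover have "w * \<phi> x1_sharp = 0"
  proof -
    have "w * \<phi> x1_sharp = - w * (v P1 * v Y1) - (w * v P3) * v X1
      + (w * (v P2 * v S3) - (w * v P4) * v T3) * v X1 + (w * (v P2 * v S4) - (w * v P4) * v T4) * v X2"
      by (simp add: x1_sharp_def \<phi>.simps v u algebra_simps)
    also have "\<dots> = 0"
      unfolding eqs numerators by (simp add: w_def q_t_def algebra_simps power2_eq_square)
    finally show ?thesis .
  qed
  moreover have "w * \<phi> x2_sharp = 0"
  proof -
    have "w * \<phi> x2_sharp = - w * (v P1 * v Y2) - (w * v P3) * v X2
      - (w * (v P2 * v S2) - (w * v P4) * v T2) * v X1 - (w * (v P2 * v S3) - (w * v P4) * v T3) * v X2"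
      by (simp add: x2_sharp_def \<phi>.simps v u algebra_simps)
    also have "\<dots> = 0"
      unfolding eqs numerators by (simp add: w_def q_t_def algebra_simps power2_eq_square)
    finally show ?thesis .
  qed
  moreover have "w * \<phi> y1_sharp = 0"
  proof -
    have "w * \<phi> y1_sharp = (- (w * v Z) * v P1 + v P2 * (w * v S1) - (w * v P4) * v T1) * v X1
      - (w * v P3) * v Y1 - (w * (v P2 * v S3) - (w * v P4) * v T3) * v Y1
      - (w * (v P2 * v S4) - (w * v P4) * v T4) * v Y2"
      by (simp add: y1_sharp_def \<phi>.simps v u algebra_simps)
    also have "\<dots> = 0"
      unfolding eqs numerators by (simp add: w_def q_t_def algebra_simps power2_eq_square)
    finally show ?thesis .
  qed
  moreover have "w * \<phi> y2_sharp = 0"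
  proof -
    have "w * \<phi> y2_sharp = (- (w * v Z) * v P1 + v P2 * (w * v S1) - (w * v P4) * v T1) * v X2
      - (w * v P3) * v Y2 + (w * (v P2 * v S2) - (w * v P4) * v T2) * v Y1
      + (w * (v P2 * v S3) - (w * v P4) * v T3) * v Y2"
      by (simp add: y2_sharp_def \<phi>.simps v u algebra_simps)
    also have "\<dots> = 0"
      unfolding eqs numerators by (simp add: w_def q_t_def algebra_simps power2_eq_square)
    finally show ?thesis .
  qed
  ultimately have "\<phi> p1_sharp = 0" "\<phi> p2_sharp = 0" "\<phi> p3_sharp = 0" "\<phi> p4_sharp = 0"
    "\<phi> x1_sharp = 0" "\<phi> x2_sharp = 0" "\<phi> y1_sharp = 0" "\<phi> y2_sharp = 0"
    using nonzero(2)[folded w_def] by simp_all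
  moreover from this have "\<phi> u_sharp = 0"
    using kills_u_sharp[OF \<phi>.ring_morphism_axioms] nonzero v by simp
  ultimately show ?thesis using g by (elim insertE) simp_all
qed

definition fraction :: "upsilon_poly \<Rightarrow> upsilon_poly fract" where
  "fraction f = Fract f 1"

interpretation fraction: ring_morphism fraction
  by standard (simp_all add: fraction_def One_fract_def)

lemma fraction_eq_0_iff: "fraction f = 0 \<longleftrightarrow> f = 0"
  by (simp add: fraction_def Zero_fract_def eq_fract)

interpretation coefficient: ring_morphism "\<lambda>a. fraction (Poly_Mapping.single 0 a)"
proof
  show "fraction (Poly_Mapping.single 0 (a * b))
    = fraction (Poly_Mapping.single 0 a) * fraction (Poly_Mapping.single 0 b)" for a b
    unfolding fraction.mult[symmetric] by (simp add: mult_single)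
qed (simp_all add: single_add fraction.add fraction.one)

definition chart :: "coord \<Rightarrow> upsilon_poly fract" where
  "chart c = (let q = fraction (q_t var) in case c of U \<Rightarrow> 0
     | Z \<Rightarrow> fraction (z_numerator var) / q | S1 \<Rightarrow> fraction (s1_numerator var) / q
     | P3 \<Rightarrow> fraction (p3_numerator var) / q | P4 \<Rightarrow> fraction (p4_numerator var) / q
     | _ \<Rightarrow> fraction (var c))"

definition Chi :: "upsilon_poly \<Rightarrow> upsilon_poly fract" where
  "Chi = evaluate (\<lambda>a. fraction (Poly_Mapping.single 0 a)) chart"

interpretation Chi: ring_morphism Chi
  unfolding Chi_def by (rule coefficient.evaluate_morphism)

lemma Chi_var: "Chi (var c) = chart c"
  unfolding Chi_def var_def by (rule coefficient.evaluate_variable)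

lemma Chi_const: "Chi (Poly_Mapping.single 0 a) = fraction (Poly_Mapping.single 0 a)"
  unfolding Chi_def by (rule coefficient.evaluate_const)

lemma chart_free: "c \<notin> {U, Z, S1, P3, P4} \<Longrightarrow> chart c = fraction (var c)"
  unfolding chart_def by (cases c) simp_all

lemmas chart_polynomials = q_t_def z_numerator_def s1_numerator_def p3_numerator_def
  p4_numerator_def q_s_def

lemma Chi_chart_polynomials:
  "Chi (q_t var) = fraction (q_t var)" "Chi (z_numerator var) = fraction (z_numerator var)"
  "Chi (s1_numerator var) = fraction (s1_numerator var)"
  "Chi (p3_numerator var) = fraction (p3_numerator var)"
  "Chi (p4_numerator var) = fraction (p4_numerator var)"
  by (simp_all add: chart_polynomials Chi.simps fraction.simps Chi_var chart_free)

lemma q_t_nonzero: "q_t var \<noteq> (0 :: upsilon_poly)"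
proof
  assume "q_t var = (0 :: upsilon_poly)"
  then have "q_t lvar = 0" using Phi_q_t Phi.zero by metis
  then show False using lead_max(1)[OF has_lead_q_t] by simp
qed

lemma Chi_kills_ideal: "f \<in> upsilon_ideal \<Longrightarrow> Chi f = 0"
proof (rule morphism_kills_ideal[OF Chi.ring_morphism_axioms])
  have q: "q_t chart = fraction (q_t var)" and n: "z_numerator chart = fraction (z_numerator var)"
    "s1_numerator chart = fraction (s1_numerator var)" "p3_numerator chart = fraction (p3_numerator var)"
    "p4_numerator chart = fraction (p4_numerator var)"
    by (simp_all add: chart_polynomials fraction.simps chart_free)
  have q0: "fraction (q_t var) \<noteq> 0" using q_t_nonzero fraction_eq_0_iff by blast
  have "var X1 \<noteq> (0 :: upsilon_poly)"
    using lookup_single_eq[of "Poly_Mapping.single X1 (1::nat)" "1 :: complex"]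
    unfolding var_def by (metis lookup_zero zero_neq_one)
  then have X1: "chart X1 \<noteq> 0" by (simp add: chart_free fraction_eq_0_iff)
  have "chart U = 0" "q_t chart * chart Z = z_numerator chart" "q_t chart * chart S1 = s1_numerator chart"
    "q_t chart * chart P3 = p3_numerator chart" "q_t chart * chart P4 = p4_numerator chart"
    unfolding q n using q0 by (simp_all add: chart_def)
  then show "Chi g = 0" if "g \<in> upsilon_generators" for g
    using chart_kills[OF Chi.ring_morphism_axioms Chi_var _ X1 _ _ _ _ _ that] q q0 by simp
qed

text \<open>Modulo \<open>u\<close>, a power of \<open>q\<^sub>t\<close> turns every polynomial into one in the free coordinates of the
  chart.\<close>

definition cleared :: "upsilon_poly \<Rightarrow> bool" where
  "cleared f \<longleftrightarrow> (\<exists>n b. Chi b = fraction b \<and> u_multiple (q_t var ^ n * f - b))"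

lemma clearedI: "Chi b = fraction b \<Longrightarrow> u_multiple (q_t var ^ n * f - b) \<Longrightarrow> cleared f"
  unfolding cleared_def by blast

lemma cleared_add:
  assumes "cleared f" "cleared g"
  shows "cleared (f + g)"
proof -
  let ?q = "q_t var :: upsilon_poly"
  obtain m a where a: "Chi a = fraction a" "u_multiple (?q ^ m * f - a)"
    using assms(1) unfolding cleared_def by blast
  obtain n b where b: "Chi b = fraction b" "u_multiple (?q ^ n * g - b)"
    using assms(2) unfolding cleared_def by blast
  have "u_multiple (?q ^ n * (?q ^ m * f - a) + ?q ^ m * (?q ^ n * g - b))"
    by (intro u_multiple_add u_multiple_mult a b)
  also have "?q ^ n * (?q ^ m * f - a) + ?q ^ m * (?q ^ n * g - b)
      = ?q ^ (m + n) * (f + g) - (?q ^ n * a + ?q ^ m * b)"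
    by (simp add: algebra_simps power_add)
  finally show ?thesis
    by (rule clearedI[rotated])
      (simp only: Chi.add Chi.mult Chi.power fraction.add fraction.mult fraction.power
        Chi_chart_polynomials a(1) b(1))
qed

lemma cleared_mult:
  assumes "cleared f" "cleared g"
  shows "cleared (f * g)"
proof -
  let ?q = "q_t var :: upsilon_poly"
  obtain m a where a: "Chi a = fraction a" "u_multiple (?q ^ m * f - a)"
    using assms(1) unfolding cleared_def by blast
  obtain n b where b: "Chi b = fraction b" "u_multiple (?q ^ n * g - b)"
    using assms(2) unfolding cleared_def by blast
  have "u_multiple ((?q ^ n * g) * (?q ^ m * f - a) + a * (?q ^ n * g - b))"
    by (intro u_multiple_add u_multiple_mult a b)
  also have "(?q ^ n * g) * (?q ^ m * f - a) + a * (?q ^ n * g - b) = ?q ^ (m + n) * (f * g) - a * b"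
    by (simp add: algebra_simps power_add)
  finally show ?thesis
    by (rule clearedI[rotated]) (simp only: Chi.mult fraction.mult a(1) b(1))
qed

lemma cleared_free: "Chi f = fraction f \<Longrightarrow> cleared f"
  using u_multiple_ideal[OF ideal_zero] by (intro clearedI[of f 0 f]) simp_all

lemma cleared_quotient:
  assumes "Chi b = fraction b" "q_t var * f = b + r" "u_multiple r"
  shows "cleared f"
  using assms by (intro clearedI[of b 1 f]) simp_all

lemma cleared_var: "cleared (var c)"
proof -
  have gen: "u_multiple g" if "g \<in> upsilon_generators" for g
    using u_multiple_ideal[OF ideal_generator[OF that]] .
  have neg: "u_multiple (- f)" if "u_multiple f" for f
    using u_multiple_mult[OF that, of "- 1"] by simp
  have U: "u_multiple (var U * f)" for f
    using u_multiple_mult[OF u_multiple_U, of f] by (simp add: mult.commute)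
  consider "c = U" | "c = Z" | "c = S1" | "c = P3" | "c = P4" | "c \<notin> {U, Z, S1, P3, P4}" by blast
  then show ?thesis
  proof cases
    case 1
    then show ?thesis
      using u_multiple_U by (intro clearedI[of 0 0]) (simp_all add: Chi.zero fraction.zero)
  next
    case 2
    have "u_multiple (- (var U * var P2) + - p2_sharp)" by (intro u_multiple_add neg U gen) simp
    then show ?thesis unfolding 2
      by (intro cleared_quotient[OF Chi_chart_polynomials(2)]) (simp_all add: q_t_times_z)
  next
    case 3
    have "u_multiple (- (var U * var P1) + - p1_sharp)" by (intro u_multiple_add neg U gen) simp
    then show ?thesis unfolding 3
      by (intro cleared_quotient[OF Chi_chart_polynomials(3)]) (simp_all add: q_t_times_s1)
  next
    case 4
    have "u_multiple (- ((var X1 * var T2 + var X2 * var T3) * x1_sharp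
        + (var X1 * var T3 + var X2 * var T4) * x2_sharp))"
      by (intro neg u_multiple_add u_multiple_mult gen) simp_all
    then show ?thesis unfolding 4
      by (intro cleared_quotient[OF Chi_chart_polynomials(4)]) (simp_all add: q_t_times_p3)
  next
    case 5
    have "u_multiple (var X1 * x2_sharp + - (var X2 * x1_sharp))"
      by (intro neg u_multiple_add u_multiple_mult gen) simp_all
    then show ?thesis unfolding 5
      by (intro cleared_quotient[OF Chi_chart_polynomials(5)]) (simp_all add: q_t_times_p4)
  next
    case 6
    then show ?thesis by (intro cleared_free) (simp add: Chi_var chart_free)
  qed
qed

lemma cleared_all: "cleared f"
proof (induction f rule: polynomial_induct)
  case (const a)
  show ?case by (rule cleared_free[OF Chi_const])
next
  case (variable c)
  show ?case using cleared_var[of c] by (simp add: var_def)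
qed (simp_all add: cleared_add cleared_mult)

lemma u_multiple_iff_Chi: "u_multiple f \<longleftrightarrow> Chi f = 0"
proof
  assume "u_multiple f"
  then obtain h where "Phi f = lvar U * Phi h" unfolding u_multiple_def by blast
  then have "Phi (f - var U * h) = 0" by (simp add: Phi.simps Phi_var_outside)
  then have "Chi (f - var U * h) = 0" using kernel_Phi Chi_kills_ideal by blast
  then show "Chi f = 0" by (simp add: Chi.simps Chi_var chart_def)
next
  assume "Chi f = 0"
  obtain n b where b: "Chi b = fraction b" "u_multiple (q_t var ^ n * f - b)"
    using cleared_all unfolding cleared_def by blast
  obtain h where "Phi (q_t var ^ n * f - b) = lvar U * Phi h" using b(2) unfolding u_multiple_def by blast
  then have "Phi (q_t var ^ n * f - b - var U * h) = 0" by (simp add: Phi.simps Phi_var_outside)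
  then have "Chi (q_t var ^ n * f - b - var U * h) = 0" using kernel_Phi Chi_kills_ideal by blast
  then have "fraction b = 0" using \<open>Chi f = 0\<close> b(1) by (simp add: Chi.simps Chi_var chart_def)
  then have "u_multiple (q_t var ^ n * f)" using b(2) fraction_eq_0_iff by simp
  then show "u_multiple f"
    by (induction n) (auto simp: mult.assoc intro: u_multiple_cancel_q_t)
qed

theorem u_multiple_prime: "u_multiple (f * g) \<Longrightarrow> u_multiple f \<or> u_multiple g"
  by (simp add: u_multiple_iff_Chi Chi.mult)
section \<open>Factoriality\<close>

type_synonym 'a poly5 = "'a poly poly poly poly poly"

text \<open>Fourteen variables: \<open>u\<close> and the thirteen coordinates that are neither \<open>u\<close> nor one of the \<open>p\<^sub>i\<close>.\<close>

type_synonym nested_poly = "complex poly5 poly5 poly poly poly poly"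

definition model_in_image :: "('q::idom \<Rightarrow> laurent) \<Rightarrow> coord set \<Rightarrow> bool" where
  "model_in_image j V \<longleftrightarrow> polynomial_model j V \<and> range j \<subseteq> range Phi"

lemma model_in_image_adjoin:
  assumes "model_in_image j V" "c \<notin> V" "c \<notin> {P1, P2, P3, P4}"
  shows "model_in_image (adjoin j c) (insert c V)"
proof -
  interpret polynomial_model j V using assms(1) unfolding model_in_image_def by blast
  have "adjoin j c p \<in> range Phi" for p
  proof (rule adjoin_in)
    show "j q \<in> range Phi" for q using assms(1) unfolding model_in_image_def by blast
    show "Poly_Mapping.single (Poly_Mapping.single c 1) 1 \<in> range Phi"
      using Phi_var_outside[OF assms(3)] unfolding lvar_def by (metis rangeI)
    show "a + b \<in> range Phi" if "a \<in> range Phi" "b \<in> range Phi" for a b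
      using that by (auto simp flip: Phi.add)
    show "a * b \<in> range Phi" if "a \<in> range Phi" "b \<in> range Phi" for a b
      using that by (auto simp flip: Phi.mult)
  qed
  then show ?thesis using adjoin_model[OF assms(2)] unfolding model_in_image_def by blast
qed

lemma nested_model:
  obtains j :: "nested_poly \<Rightarrow> laurent"
  where "model_in_image j (UNIV - {P1, P2, P3, P4})"
proof -
  have "Poly_Mapping.single 0 a \<in> range Phi" for a by (metis Phi_const rangeI)
  then have "model_in_image (Poly_Mapping.single 0 :: complex \<Rightarrow> laurent) {}"
    unfolding model_in_image_def using polynomial_model_constants by blast
  from model_in_image_adjoin[OF this, of U] have "\<exists>j :: complex poly \<Rightarrow> laurent. model_in_image j {U}" by auto
  then have "\<exists>j :: complex poly poly \<Rightarrow> laurent. model_in_image j {X1, U}"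
    using model_in_image_adjoin[where c = X1] by fastforce
  then have "\<exists>j :: complex poly poly poly \<Rightarrow> laurent. model_in_image j {X2, X1, U}"
    using model_in_image_adjoin[where c = X2] by fastforce
  then have "\<exists>j :: complex poly poly poly poly \<Rightarrow> laurent. model_in_image j {Y1, X2, X1, U}"
    using model_in_image_adjoin[where c = Y1] by fastforce
  then have "\<exists>j :: complex poly poly poly poly poly \<Rightarrow> laurent. model_in_image j {Y2, Y1, X2, X1, U}"
    using model_in_image_adjoin[where c = Y2] by fastforce
  then have "\<exists>j :: complex poly poly poly poly poly poly \<Rightarrow> laurent. model_in_image j {Z, Y2, Y1, X2, X1, U}"
    using model_in_image_adjoin[where c = Z] by fastforce
  then have "\<exists>j :: complex poly poly poly poly poly poly poly \<Rightarrow> laurent. model_in_image j {S1, Z, Y2, Y1, X2, X1, U}"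
    using model_in_image_adjoin[where c = S1] by fastforce
  then have "\<exists>j :: complex poly poly poly poly poly poly poly poly \<Rightarrow> laurent. model_in_image j {S2, S1, Z, Y2, Y1, X2, X1, U}"
    using model_in_image_adjoin[where c = S2] by fastforce
  then have "\<exists>j :: complex poly poly poly poly poly poly poly poly poly \<Rightarrow> laurent. model_in_image j {S3, S2, S1, Z, Y2, Y1, X2, X1, U}"
    using model_in_image_adjoin[where c = S3] by fastforce
  then have "\<exists>j :: complex poly poly poly poly poly poly poly poly poly poly \<Rightarrow> laurent. model_in_image j {S4, S3, S2, S1, Z, Y2, Y1, X2, X1, U}"
    using model_in_image_adjoin[where c = S4] by fastforce
  then have "\<exists>j :: complex poly poly poly poly poly poly poly poly poly poly poly \<Rightarrow> laurent. model_in_image j {T1, S4, S3, S2, S1, Z, Y2, Y1, X2, X1, U}"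
    using model_in_image_adjoin[where c = T1] by fastforce
  then have "\<exists>j :: complex poly poly poly poly poly poly poly poly poly poly poly poly \<Rightarrow> laurent. model_in_image j {T2, T1, S4, S3, S2, S1, Z, Y2, Y1, X2, X1, U}"
    using model_in_image_adjoin[where c = T2] by fastforce
  then have "\<exists>j :: complex poly poly poly poly poly poly poly poly poly poly poly poly poly \<Rightarrow> laurent. model_in_image j {T3, T2, T1, S4, S3, S2, S1, Z, Y2, Y1, X2, X1, U}"
    using model_in_image_adjoin[where c = T3] by fastforce
  then have "\<exists>j :: complex poly poly poly poly poly poly poly poly poly poly poly poly poly poly \<Rightarrow> laurent. model_in_image j {T4, T3, T2, T1, S4, S3, S2, S1, Z, Y2, Y1, X2, X1, U}"
    using model_in_image_adjoin[where c = T4] by fastforce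
  then obtain j :: "nested_poly \<Rightarrow> laurent" where "model_in_image j {T4, T3, T2, T1, S4, S3, S2, S1, Z, Y2, Y1, X2, X1, U}" by blast
  moreover have "{T4, T3, T2, T1, S4, S3, S2, S1, Z, Y2, Y1, X2, X1, U} = UNIV - {P1, P2, P3, P4}" unfolding UNIV_coord by auto
  ultimately show ?thesis using that by simp
qed

text \<open>With \<open>z\<close> in degree \<open>0\<close> and the other variables of the Laurent ring in degree \<open>1\<close>, the images
  of all coordinates have nonnegative degree. As \<open>u\<close> has degree \<open>1\<close>, a multiple of \<open>u\<^sup>n\<close> only
  involves exponents of degree at least \<open>n\<close>.\<close>

definition negative_degree :: "coord \<Rightarrow> int" where
  "negative_degree c = (if c = Z then 0 else - 1)"

lemma image_degree: "weight_le (exponent_weight negative_degree) 0 (image c)"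
proof -
  note intros = exponent_weight_lvar[of negative_degree] exponent.weight_le_intros[of negative_degree]
  have var: "weight_le (exponent_weight negative_degree) 0 (lvar c)" for c
    by (rule exponent.weight_le_mono, rule exponent_weight_lvar) (simp add: negative_degree_def)
  have inv: "weight_le (exponent_weight negative_degree) 1 u_inv"
    using exponent.weight_le_single[of negative_degree "Poly_Mapping.single U (- 1)" 1]
    by (simp add: u_inv_def exponent_weight_single negative_degree_def)
  have "weight_le (exponent_weight negative_degree) (- 1) (u_times_p1 lvar)"
    unfolding u_times_p1_def by (rule exponent.weight_le_mono, (rule intros)+, simp add: negative_degree_def)
  moreover have "weight_le (exponent_weight negative_degree) (- 1) (u_times_p2 lvar)"
    unfolding u_times_p2_def by (rule exponent.weight_le_mono, (rule intros)+, simp add: negative_degree_def)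
  moreover have "weight_le (exponent_weight negative_degree) (- 1) (u_times_p3 lvar)"
    unfolding u_times_p3_def by (rule exponent.weight_le_mono, (rule intros)+, simp add: negative_degree_def)
  moreover have "weight_le (exponent_weight negative_degree) (- 1) (u_times_p4 lvar)"
    unfolding u_times_p4_def by (rule exponent.weight_le_mono, (rule intros)+, simp add: negative_degree_def)
  ultimately show ?thesis
    using var[of c] exponent.weight_le_mult[OF inv, of "- 1"]
    by (cases c) (simp_all add: image_def)
qed

lemma Phi_degree: "weight_le (exponent_weight negative_degree) 0 (Phi f)"
proof (induction f rule: polynomial_induct)
  case (const a)
  show ?case unfolding Phi_const by (rule exponent.weight_le_const)
next
  case (variable c)
  show ?case using image_degree Phi_var[of c] by (simp add: var_def)
next
  case (add f g)
  then show ?case using exponent.weight_le_add[OF add.IH] by (simp add: Phi.add)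
next
  case (mult f g)
  then show ?case using exponent.weight_le_mult[OF mult.IH] by (simp add: Phi.mult)
qed

lemma finitely_many_u_powers:
  assumes "Phi f \<noteq> 0"
  shows "\<exists>N. \<forall>n. \<forall>b\<in>range Phi. Phi f = lvar U ^ n * b \<longrightarrow> n \<le> N"
proof -
  obtain e where e: "e \<in> Poly_Mapping.keys (Phi f)" using assms by (metis keys_eq_empty ex_in_conv)
  have "n \<le> nat (- exponent_weight negative_degree e)" if n: "Phi f = lvar U ^ n * Phi h" for n h
  proof -
    have "weight_le (exponent_weight negative_degree) (- int n) (lvar U ^ n)"
    proof (induction n)
      case 0
      show ?case using exponent.weight_le_one by simp
    next
      case (Suc n)
      show ?case
        using exponent.weight_le_mult[OF exponent_weight_lvar[of negative_degree U] Suc]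
        by (simp add: negative_degree_def)
    qed
    from exponent.weight_le_mult[OF this Phi_degree]
    have "weight_le (exponent_weight negative_degree) (- int n) (Phi f)" unfolding n by simp
    then have "exponent_weight negative_degree e \<le> - int n" using e unfolding weight_le_def by blast
    then show ?thesis by linarith
  qed
  then show ?thesis by blast
qed

lemma (in ring_morphism) u_times_values:
  "\<phi> (u_times_p1 v) = u_times_p1 (\<lambda>c. \<phi> (v c))" "\<phi> (u_times_p2 v) = u_times_p2 (\<lambda>c. \<phi> (v c))"
  "\<phi> (u_times_p3 v) = u_times_p3 (\<lambda>c. \<phi> (v c))" "\<phi> (u_times_p4 v) = u_times_p4 (\<lambda>c. \<phi> (v c))"
  by (simp_all add: u_times_p1_def u_times_p2_def u_times_p3_def u_times_p4_def simps)

text \<open>Only the \<open>p\<^sub>i\<close> have a denominator, and it is \<open>u\<close>.\<close>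

lemma model_in_image_clear_u:
  assumes model: "model_in_image j (UNIV - {P1, P2, P3, P4})"
  shows "\<exists>n q. lvar U ^ n * Phi f = j q"
proof -
  interpret j: polynomial_model j "UNIV - {P1, P2, P3, P4}" using model unfolding model_in_image_def by blast
  have "\<exists>q. c \<notin> {P1, P2, P3, P4} \<longrightarrow> j q = lvar c" for c
    using j.variables[of c] unfolding lvar_def by (metis Diff_iff UNIV_I rangeE)
  then obtain x where x: "c \<notin> {P1, P2, P3, P4} \<Longrightarrow> j (x c) = lvar c" for c by metis
  show ?thesis
  proof (induction f rule: polynomial_induct)
    case (const a)
    obtain q where "j q = Poly_Mapping.single 0 a" using j.constants by (metis rangeE)
    then show ?case by (intro exI[of _ 0] exI[of _ q]) (simp add: Phi_const)
  next
    case (variable c)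
    have u: "lvar U * (u_inv * a) = a" for a
      using u_inv_times_u by (metis mult.assoc mult.commute mult_1)
    have p: "j (u_times_p1 x) = u_times_p1 lvar" "j (u_times_p2 x) = u_times_p2 lvar"
      "j (u_times_p3 x) = u_times_p3 lvar" "j (u_times_p4 x) = u_times_p4 lvar"
      unfolding j.u_times_values by (simp_all add: u_times_p1_def u_times_p2_def u_times_p3_def u_times_p4_def x)
    consider "c = P1" | "c = P2" | "c = P3" | "c = P4" | "c \<notin> {P1, P2, P3, P4}" by blast
    then have "\<exists>n q. lvar U ^ n * Phi (var c) = j q"
    proof cases
      case 1
      then show ?thesis by (intro exI[of _ 1] exI[of _ "u_times_p1 x"]) (simp add: Phi_var image_def u p)
    next
      case 2
      then show ?thesis by (intro exI[of _ 1] exI[of _ "u_times_p2 x"]) (simp add: Phi_var image_def u p)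
    next
      case 3
      then show ?thesis by (intro exI[of _ 1] exI[of _ "u_times_p3 x"]) (simp add: Phi_var image_def u p)
    next
      case 4
      then show ?thesis by (intro exI[of _ 1] exI[of _ "u_times_p4 x"]) (simp add: Phi_var image_def u p)
    next
      case 5
      then show ?thesis
        by (intro exI[of _ 0] exI[of _ "x c"]) (simp add: Phi_var_outside x)
    qed
    then show ?case by (simp add: var_def)
  next
    case (add f g)
    then obtain m a n b where ab: "lvar U ^ m * Phi f = j a" "lvar U ^ n * Phi g = j b" by blast
    have "lvar U ^ (m + n) * Phi (f + g)
        = lvar U ^ n * (lvar U ^ m * Phi f) + lvar U ^ m * (lvar U ^ n * Phi g)"
      by (simp add: Phi.add power_add algebra_simps)
    also have "\<dots> = j (x U ^ n * a + x U ^ m * b)" by (simp add: ab j.simps x)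
    finally show ?case by blast
  next
    case (mult f g)
    then obtain m a n b where ab: "lvar U ^ m * Phi f = j a" "lvar U ^ n * Phi g = j b" by blast
    have "lvar U ^ (m + n) * Phi (f * g) = (lvar U ^ m * Phi f) * (lvar U ^ n * Phi g)"
      by (simp add: Phi.mult power_add algebra_simps)
    also have "\<dots> = j (a * b)" by (simp add: ab j.mult)
    finally show ?case by blast
  qed
qed

lemma divides_in_u_multiple: "divides_in (range Phi) (lvar U) (Phi f) \<longleftrightarrow> u_multiple f"
  unfolding divides_in_def u_multiple_def by auto

lemma nagata_Phi:
  fixes j :: "'q::{idom, factorial_semiring} \<Rightarrow> laurent"
  assumes model: "model_in_image j (UNIV - {P1, P2, P3, P4})" and v: "j v = lvar U"
  shows "nagata (range Phi) j v (lvar U)"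
proof -
  interpret j: polynomial_model j "UNIV - {P1, P2, P3, P4}" using model unfolding model_in_image_def by blast
  show ?thesis
  proof
    show "1 \<in> range Phi" by (metis Phi.one rangeI)
    show "a * b \<in> range Phi" if "a \<in> range Phi" "b \<in> range Phi" for a b
      using that by (auto simp flip: Phi.mult)
    show "inj j"
    proof
      fix a b assume "j a = j b"
      then have "j (a - b) = 0" by (simp add: j.diff)
      then show "a = b" using j.kernel by fastforce
    qed
    show "j p \<in> range Phi" for p using model unfolding model_in_image_def by blast
    show "lvar U \<noteq> 0"
      using u_inv_times_u by (metis mult_zero_right zero_neq_one)
    show "divides_in (range Phi) (lvar U) a \<or> divides_in (range Phi) (lvar U) b"
      if ab: "a \<in> range Phi" "b \<in> range Phi" "divides_in (range Phi) (lvar U) (a * b)" for a b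
    proof -
      obtain f g where fg: "a = Phi f" "b = Phi g" using ab by blast
      then have "u_multiple (f * g)" using ab(3) divides_in_u_multiple[of "f * g"] by (simp add: Phi.mult)
      then show ?thesis unfolding fg divides_in_u_multiple by (rule u_multiple_prime)
    qed
    show "\<exists>n q. lvar U ^ n * a = j q" if "a \<in> range Phi" for a
      using that model_in_image_clear_u[OF model] by blast
    show "\<exists>N. \<forall>n. \<forall>b\<in>range Phi. a = lvar U ^ n * b \<longrightarrow> n \<le> N" if a: "a \<in> range Phi" "a \<noteq> 0" for a
    proof -
      obtain f where "a = Phi f" using a(1) by blast
      then show ?thesis using finitely_many_u_powers a(2) by blast
    qed
  qed (rule j.mult j.one j.zero v)+
qed

theorem proposition3p8:
  shows "factorial_domain R_Upsilon"
proof -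
  obtain j :: "nested_poly \<Rightarrow> laurent" where model: "model_in_image j (UNIV - {P1, P2, P3, P4})"
    by (rule nested_model)
  then interpret j: polynomial_model j "UNIV - {P1, P2, P3, P4}" unfolding model_in_image_def by blast
  obtain v where v: "j v = lvar U" using j.variables[of U] unfolding lvar_def by (auto elim: rangeE)
  interpret nagata "range Phi" j v "lvar U" by (rule nagata_Phi[OF model v])
  have "factorial_domain (ring_of_type_algebra Quot {f. Phi f = 0})"
    by (rule factorial_domain_quotient[OF Phi.add Phi.mult Phi.one prime_product_all])
  then show ?thesis unfolding R_Upsilon_def upsilon_poly_ring_def kernel_Phi .
qed

end
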